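(* Let $\mathcal{I}=\{1,\dots,\mathrm{m}\}$, let $\mathcal{F}=\{f_1,\dots,f_{\mathrm{m}}\}\subset\Sigma(\mathbb{R}^n)$, and let $\tau>0$. The switched system $\dot x(t)=f_{\sigma(t)}(x(t))$ is $\tau$-dependent uniformly globally bounded ($\tau$-UGB) if and only if there exist functions $W_1,\dots,W_{\mathrm{m}}\in \mathrm{Lip}_0(\mathbb{R}^n,\mathbb{R})$, functions $\widetilde\alpha_1,\widetilde\alpha_2\in\mathcal{K}_\infty$ and a number $\alpha\ge 0$ such that $$\widetilde\alpha_1(|x|)\le W_i(x)\le\widetilde\alpha_2(|x|)\qquad\forall i\in\mathcal{I},\ \forall x\in\mathbb{R}^n,$$ $$D^+_{f_i}W_i(x)\le -(1+\alpha)W_i(x)\qquad\forall i\in\mathcal{I},\ \forall x\in\mathbb{R}^n,$$ $$W_i(x)\le e^{\alpha\tau}W_j(x)\qquad\forall (i,j)\in\mathcal{I}^2,\ \forall x\in\mathbb{R}^n.$$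
   Context: Notation: $\mathbb{R}_+=[0,\infty)$; $|\cdot|$ is the Euclidean norm; $\mathrm{m}\in\mathbb{N}\setminus\{0\}$. A function $\alpha:\mathbb{R}_+\to\mathbb{R}$ is of class $\mathcal{K}$ if it is continuous, strictly increasing and $\alpha(0)=0$; it is of class $\mathcal{K}_\infty$ if moreover it is unbounded. $\mathrm{Lip}_0(\mathbb{R}^n,\mathbb{R}^m)$ is the set of functions $\mathbb{R}^n\to\mathbb{R}^m$ that are locally Lipschitz on the open set $\mathbb{R}^n\setminus\{0\}$. Class $\Sigma(\mathbb{R}^n)$: $f\in\Sigma(\mathbb{R}^n)$ means $f\in\mathrm{Lip}_0(\mathbb{R}^n,\mathbb{R}^n)$, $f(0)=0$, and for the ODE $\dot x=f(x)$ existence, uniqueness and forward completeness of forward solutions (in the sense of Carathéodory, i.e. absolutely continuous functions satisfying the ODE almost everywhere) hold for every initial condition $x_0\in\mathbb{R}^n$ ($f$ need not be continuous at $0$). For $f_i\in\Sigma(\mathbb{R}^n)$, $\Phi_i(t,x)$ denotes the solution at time $t\in\mathbb{R}_+$ of $\dot x=f_i(x)$ starting at $x$. Switching signals: $\mathcal{S}$ is the set of piecewise constant, right-continuous functions $\sigma:\mathbb{R}_+\to\mathcal{I}$ (the set of discontinuity points is finite, or infinite and unbounded with finitely many points in each bounded interval). For $\sigma\in\mathcal{S}$ and $0\le s\le t$, $N_\sigma(s,t)$ is the number of discontinuity points of $\sigma$ in $[s,t)$, where by convention the time $0$ is always counted as a discontinuity point. $\Phi_\sigma(t,x)$ is the solution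 at time $t$ of $\dot x(t)=f_{\sigma(t)}(x(t))$, $x(0)=x$. Dini derivative: for $V\in\mathrm{Lip}_0(\mathbb{R}^n,\mathbb{R})$ continuous, $D^+_{f_i}V(x):=\limsup_{h\to0^+}\frac{V(\Phi_i(h,x))-V(x)}{h}$. $\tau$-UGB: the switched system is $\tau$-dependent uniformly globally bounded ($\tau$-UGB) if there exist $\eta_1,\eta_2\in\mathcal{K}_\infty$ and $\alpha\ge0$ such that $$|\Phi_\sigma(t,x)|\le\eta_1\big(e^{\alpha\tau N_\sigma(0,t)}e^{-(1+\alpha)t}\eta_2(|x|)\big)\qquad\forall\sigma\in\mathcal{S},\ \forall x\in\mathbb{R}^n,\ \forall t\in\mathbb{R}_+.$$ *)

theory Defs
  imports "HOL-Analysis.Analysis"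
begin

(* Functions on [0,\<infinity>) are total functions on real; their values at negative arguments
   are never used. *)

definition class_K :: "(real \<Rightarrow> real) set" where
  "class_K = {a. continuous_on {0..} a \<and> strict_mono_on {0..} a \<and> a 0 = 0}"

definition class_Kinf :: "(real \<Rightarrow> real) set" where
  "class_Kinf = {a \<in> class_K. \<not> bounded (a ` {0..})}"

(* The library notion local_lipschitz is for time-dependent families; for the family that is
   constant in time it is ordinary local Lipschitz continuity. Nothing is required at 0. *)
definition Lip0 :: "('a::euclidean_space \<Rightarrow> 'b::euclidean_space) set" where
  "Lip0 = {g. local_lipschitz (UNIV :: real set) (- {0}) (\<lambda>_. g)}"

(* The divisions range over finite families of non-overlapping closed subintervals [a,b] of J. *)
definition absolutely_continuous_on :: "real set \<Rightarrow> (real \<Rightarrow> 'a::euclidean_space) \<Rightarrow> bool" where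
  "absolutely_continuous_on J u \<longleftrightarrow>
     (\<forall>\<epsilon>>0. \<exists>\<delta>>0. \<forall>d. d division_of \<Union>d \<and> \<Union>d \<subseteq> J \<and> (\<Sum>k\<in>d. Sup k - Inf k) < \<delta> \<longrightarrow>
        (\<Sum>k\<in>d. norm (u (Sup k) - u (Inf k))) < \<epsilon>)"

(* Caratheodory solutions of x' = F t x with x(0) = x0 on an interval J whose left endpoint 0
   belongs to J. Absolute continuity is local, i.e. on compact subintervals of J. *)
definition carath_solution ::
    "(real \<Rightarrow> 'a::euclidean_space \<Rightarrow> 'a) \<Rightarrow> real set \<Rightarrow> 'a \<Rightarrow> (real \<Rightarrow> 'a) \<Rightarrow> bool" where
  "carath_solution F J x0 u \<longleftrightarrow>
     u 0 = x0 \<and>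
     (\<forall>a b. {a..b} \<subseteq> J \<longrightarrow> absolutely_continuous_on {a..b} u) \<and>
     (AE t in lebesgue. t \<in> J \<longrightarrow> (u has_vector_derivative F t (u t)) (at t within J))"

(* The last three conjuncts: existence, uniqueness, forward completeness. *)
definition Sigma_class :: "('a::euclidean_space \<Rightarrow> 'a) set" where
  "Sigma_class = {g. g \<in> Lip0 \<and> g 0 = 0 \<and>
     (\<forall>x0. \<exists>T>0. \<exists>u. carath_solution (\<lambda>_. g) {0..<T} x0 u) \<and>
     (\<forall>x0. \<forall>T>0. \<forall>u v. carath_solution (\<lambda>_. g) {0..<T} x0 u \<and>
        carath_solution (\<lambda>_. g) {0..<T} x0 v \<longrightarrow> (\<forall>t\<in>{0..<T}. u t = v t)) \<and>
     (\<forall>x0. \<forall>T>0. \<forall>u. carath_solution (\<lambda>_. g) {0..<T} x0 u \<longrightarrow>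
        (\<exists>v. carath_solution (\<lambda>_. g) {0..} x0 v \<and> (\<forall>t\<in>{0..<T}. v t = u t)))}"

(* The value at time t of the solution of x' = F t x starting at x0. It is meaningful only when
   the global solution exists and is unique, as is the case for the autonomous systems of
   Sigma_class and, by concatenation, for systems switching between them. *)
definition flow :: "(real \<Rightarrow> 'a::euclidean_space \<Rightarrow> 'a) \<Rightarrow> real \<Rightarrow> 'a \<Rightarrow> 'a" where
  "flow F t x0 = (THE y. \<exists>u. carath_solution F {0..} x0 u \<and> u t = y)"

abbreviation mode_flow :: "('a::euclidean_space \<Rightarrow> 'a) \<Rightarrow> real \<Rightarrow> 'a \<Rightarrow> 'a" where
  "mode_flow g \<equiv> flow (\<lambda>_. g)"

abbreviation switched_flow ::
    "(nat \<Rightarrow> 'a::euclidean_space \<Rightarrow> 'a) \<Rightarrow> (real \<Rightarrow> nat) \<Rightarrow> real \<Rightarrow> 'a \<Rightarrow> 'a" where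
  "switched_flow f \<sigma> \<equiv> flow (\<lambda>t. f (\<sigma> t))"

(* nat carries the discrete topology, so discontinuities are exactly the jumps. *)
definition disc_points :: "(real \<Rightarrow> nat) \<Rightarrow> real set" where
  "disc_points \<sigma> = {t. 0 \<le> t \<and> \<not> continuous (at t within {0..}) \<sigma>}"

(* Finitely many discontinuities in each bounded interval: the set of discontinuities is then
   either finite, or infinite and unbounded. *)
definition switching_signals :: "nat \<Rightarrow> (real \<Rightarrow> nat) set" where
  "switching_signals m = {\<sigma>. \<sigma> ` {0..} \<subseteq> {1..m} \<and>
     (\<forall>t\<ge>0. continuous (at_right t) \<sigma>) \<and>
     (\<forall>T. finite (disc_points \<sigma> \<inter> {0..T})) \<and>
     (\<forall>a b. 0 \<le> a \<and> a < b \<and> disc_points \<sigma> \<inter> {a<..<b} = {} \<longrightarrow> \<sigma> constant_on {a<..<b})}"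

(* Time 0 always counts as a discontinuity. In particular the count over [0,t) is at least 1
   for t > 0, and it is 0 for t = 0. *)
definition num_disc :: "(real \<Rightarrow> nat) \<Rightarrow> real \<Rightarrow> real \<Rightarrow> nat" where
  "num_disc \<sigma> s t = card (insert 0 (disc_points \<sigma>) \<inter> {s..<t})"

definition upper_dini ::
    "('a::euclidean_space \<Rightarrow> 'a) \<Rightarrow> ('a \<Rightarrow> real) \<Rightarrow> 'a \<Rightarrow> ereal" where
  "upper_dini g V x = Limsup (at_right 0) (\<lambda>h. ereal ((V (mode_flow g h x) - V x) / h))"

definition tau_UGB :: "nat \<Rightarrow> (nat \<Rightarrow> 'a::euclidean_space \<Rightarrow> 'a) \<Rightarrow> real \<Rightarrow> bool" where
  "tau_UGB m f \<tau> \<longleftrightarrow> (\<exists>\<eta>1\<in>class_Kinf. \<exists>\<eta>2\<in>class_Kinf. \<exists>\<alpha>\<ge>0.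
     \<forall>\<sigma>\<in>switching_signals m. \<forall>x. \<forall>t\<ge>0.
       norm (switched_flow f \<sigma> t x)
         \<le> \<eta>1 (exp (\<alpha> * \<tau> * real (num_disc \<sigma> 0 t)) * exp (- (1 + \<alpha>) * t) * \<eta>2 (norm x)))"

end

theory Submission
  imports Defs
begin

text \<open>
  A switching signal on \<open>[0,T]\<close> is, for the purpose of the solution, a finite word of pairs (mode,
  duration), and the switched flow is the composition of the flows of single modes. The bound in
  \<open>tau_UGB\<close> is therefore a bound on the flows of words in terms of their length and their
  duration (\<open>tau_UGB_iff_words\<close>). This uses that Caratheodory solutions of the switched system exist
  and are unique, which is inherited mode by mode (\<open>switched_system_word\<close>).

  If Lyapunov functions exist, the Dini inequality integrates to exponential decay with rate
  \<open>1 + \<alpha>\<close> while a mode is active, and each switch costs at most the factor \<open>exp (\<alpha> * \<tau>)\<close>. Induction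
  on the word gives the bound, with \<open>\<eta>\<^sub>1\<close> the inverse of the lower comparison function
  (\<open>Lyapunov_functions_bound_words\<close>).

  Conversely, let \<open>V i x\<close> be the supremum, over all words that start in mode \<open>i\<close>, of the size of
  the point reached from \<open>x\<close>, rewarded by \<open>exp (1 + \<beta>)\<close> per unit of time and penalized by
  \<open>exp (\<beta> * \<tau>)\<close> per switch. Prolonging or prefixing words gives the decay and the comparison between
  modes at once. The difficulty is that \<open>V i\<close> must be locally Lipschitz away from 0, although the
  supremum runs over an infinite horizon and the vector fields may be singular at 0. Size is
  measured by a 1-Lipschitz minorant \<open>g\<close> of the cube of the inverse of \<open>\<eta>\<^sub>1\<close>, and \<open>\<beta> = 3 * \<alpha> + 1\<close>: the
  cube triples the exponents of the given bound, which leaves a surplus of decay both in the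
  number of switches and in time. Hence only words of bounded length and duration compete, their
  trajectories stay in a compact annulus around 0, and there the Gronwall inequality applies with one
  Lipschitz constant for all modes (\<open>V_locally_Lipschitz\<close>).

  The Gronwall inequality is needed for absolutely continuous functions whose derivative exists only
  almost everywhere. It rests on the fact that such a function does not increase if its
  derivative is nonpositive almost everywhere (\<open>absolutely_continuous_on_nonincreasing\<close>).
\<close>

section \<open>Absolutely continuous functions\<close>

lemma division_of_real_member:
  fixes d :: "real set set"
  assumes "d division_of S" "k \<in> d"
  shows "k = {Inf k..Sup k}" "Inf k \<le> Sup k"
proof -
  obtain p q where "k = cbox p q" "k \<noteq> {}"
    using division_ofD(3,4)[OF assms] by blast
  then show "k = {Inf k..Sup k}" "Inf k \<le> Sup k"
    by auto
qed

lemma absolutely_continuous_on_subset: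
  "absolutely_continuous_on J u \<Longrightarrow> I \<subseteq> J \<Longrightarrow> absolutely_continuous_on I u"
  unfolding absolutely_continuous_on_def by (meson order_trans)

text \<open>Sums, products of bounded factors, and products with a Lipschitz function of time are all
  instances of this domination of increments.\<close>

lemma absolutely_continuous_on_dominated:
  assumes u: "absolutely_continuous_on J u" and v: "absolutely_continuous_on J v"
    and C: "C \<ge> 0"
    and dom: "\<And>s t. s \<in> J \<Longrightarrow> t \<in> J \<Longrightarrow>
      norm (w t - w s) \<le> C * (norm (u t - u s) + norm (v t - v s) + \<bar>t - s\<bar>)"
  shows "absolutely_continuous_on J w"
  unfolding absolutely_continuous_on_def
proof (intro allI impI)
  fix \<epsilon> :: real assume "\<epsilon> > 0"
  define \<eta> where "\<eta> = \<epsilon> / (3 * (C + 1))"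
  have \<eta>: "\<eta> > 0" using \<open>\<epsilon> > 0\<close> C by (simp add: \<eta>_def)
  obtain \<delta>1 where \<delta>1: "\<delta>1 > 0" "\<And>d. d division_of \<Union>d \<and> \<Union>d \<subseteq> J \<and> (\<Sum>k\<in>d. Sup k - Inf k) < \<delta>1 \<Longrightarrow>
        (\<Sum>k\<in>d. norm (u (Sup k) - u (Inf k))) < \<eta>"
    using u \<eta> unfolding absolutely_continuous_on_def by meson
  obtain \<delta>2 where \<delta>2: "\<delta>2 > 0" "\<And>d. d division_of \<Union>d \<and> \<Union>d \<subseteq> J \<and> (\<Sum>k\<in>d. Sup k - Inf k) < \<delta>2 \<Longrightarrow>
        (\<Sum>k\<in>d. norm (v (Sup k) - v (Inf k))) < \<eta>"
    using v \<eta> unfolding absolutely_continuous_on_def by meson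
  show "\<exists>\<delta>>0. \<forall>d. d division_of \<Union> d \<and> \<Union> d \<subseteq> J \<and> (\<Sum>k\<in>d. Sup k - Inf k) < \<delta> \<longrightarrow>
        (\<Sum>k\<in>d. norm (w (Sup k) - w (Inf k))) < \<epsilon>"
  proof (intro exI[of _ "min \<eta> (min \<delta>1 \<delta>2)"] conjI allI impI)
    fix d assume d: "d division_of \<Union> d \<and> \<Union> d \<subseteq> J \<and> (\<Sum>k\<in>d. Sup k - Inf k) < min \<eta> (min \<delta>1 \<delta>2)"
    have mem: "Inf k \<in> J \<and> Sup k \<in> J \<and> \<bar>Sup k - Inf k\<bar> = Sup k - Inf k" if "k \<in> d" for k
    proof -
      have "k = {Inf k..Sup k}" "Inf k \<le> Sup k"
        using division_of_real_member d that by blast+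
      then have "Inf k \<in> k" "Sup k \<in> k" by (metis atLeastAtMost_iff order_refl)+
      then show ?thesis using d that \<open>Inf k \<le> Sup k\<close> by auto
    qed
    have "(\<Sum>k\<in>d. norm (w (Sup k) - w (Inf k)))
        \<le> (\<Sum>k\<in>d. C * (norm (u (Sup k) - u (Inf k)) + norm (v (Sup k) - v (Inf k)) + (Sup k - Inf k)))"
      by (intro sum_mono) (use dom mem in metis)
    also have "\<dots> = C * ((\<Sum>k\<in>d. norm (u (Sup k) - u (Inf k))) + (\<Sum>k\<in>d. norm (v (Sup k) - v (Inf k)))
        + (\<Sum>k\<in>d. Sup k - Inf k))"
      by (simp only: sum_distrib_left[symmetric] sum.distrib)
    also have "\<dots> \<le> C * (\<eta> + \<eta> + \<eta>)"
      using \<delta>1(2)[of d] \<delta>2(2)[of d] d C by (intro mult_left_mono add_mono) auto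
    also have "\<dots> < (C + 1) * (\<eta> + \<eta> + \<eta>)" using \<eta> by simp
    also have "\<dots> = 3 * (C + 1) * \<eta>" by (simp add: algebra_simps)
    also have "\<dots> = \<epsilon>" using C by (simp add: \<eta>_def)
    finally show "(\<Sum>k\<in>d. norm (w (Sup k) - w (Inf k))) < \<epsilon>" .
  qed (use \<eta> \<delta>1 \<delta>2 in auto)
qed

text \<open>This is the device for gluing: a function on \<open>[a,c]\<close> is, up to the constant \<open>u b\<close>, the sum of
  its two clippings to \<open>[a,b]\<close> and \<open>[b,c]\<close>.\<close>

lemma absolutely_continuous_on_clip:
  fixes u :: "real \<Rightarrow> 'a::euclidean_space"
  assumes "p \<le> q" and u: "absolutely_continuous_on {p..q} u"
  shows "absolutely_continuous_on J (\<lambda>t. u (max p (min q t)))"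
  unfolding absolutely_continuous_on_def
proof (intro allI impI)
  fix \<epsilon> :: real assume "\<epsilon> > 0"
  obtain \<delta> where \<delta>: "\<delta> > 0" "\<And>d. d division_of \<Union>d \<and> \<Union>d \<subseteq> {p..q} \<and> (\<Sum>k\<in>d. Sup k - Inf k) < \<delta> \<Longrightarrow>
        (\<Sum>k\<in>d. norm (u (Sup k) - u (Inf k))) < \<epsilon>"
    using u \<open>\<epsilon> > 0\<close> unfolding absolutely_continuous_on_def by meson
  let ?c = "\<lambda>t. max p (min q t)"
  show "\<exists>\<delta>>0. \<forall>d. d division_of \<Union> d \<and> \<Union> d \<subseteq> J \<and> (\<Sum>k\<in>d. Sup k - Inf k) < \<delta> \<longrightarrow>
        (\<Sum>k\<in>d. norm (u (?c (Sup k)) - u (?c (Inf k)))) < \<epsilon>"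
  proof (intro exI[of _ \<delta>] conjI allI impI \<delta>(1))
    fix d assume d: "d division_of \<Union> d \<and> \<Union> d \<subseteq> J \<and> (\<Sum>k\<in>d. Sup k - Inf k) < \<delta>"
    then have div: "d division_of \<Union> d" by blast
    have fin: "finite d" using division_ofD(1)[OF div] .
    \<comment> \<open>Only the members meeting \<open>[p,q]\<close> in more than a point contribute to the sum; their
      traces on \<open>[p,q]\<close> form a division again.\<close>
    define d' where "d' = {k \<in> d. max (Inf k) p < min (Sup k) q}"
    define tr where "tr k = {max (Inf k) p..min (Sup k) q}" for k :: "real set"
    have sub: "d' \<subseteq> d" by (auto simp: d'_def)
    have fin': "finite d'" using fin sub finite_subset by blast
    have tr: "tr k \<noteq> {}" "Inf (tr k) = max (Inf k) p" "Sup (tr k) = min (Sup k) q"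
        "interior (tr k) \<noteq> {}" "tr k \<subseteq> k" "tr k \<subseteq> {p..q}" if "k \<in> d'" for k
    proof -
      have "max (Inf k) p < min (Sup k) q" using that by (simp add: d'_def)
      then show "tr k \<noteq> {}" "Inf (tr k) = max (Inf k) p" "Sup (tr k) = min (Sup k) q"
        "interior (tr k) \<noteq> {}" by (auto simp: tr_def not_le)
      have "k = {Inf k..Sup k}" using division_of_real_member[OF div] that sub by blast
      then show "tr k \<subseteq> k" unfolding tr_def
        by (metis atLeastatMost_subset_iff max.cobounded1 min.cobounded1)
      show "tr k \<subseteq> {p..q}" by (auto simp: tr_def)
    qed
    have disj: "interior (tr k) \<inter> interior (tr l) = {}" if "k \<in> d'" "l \<in> d'" "k \<noteq> l" for k l
    proof -
      have "interior k \<inter> interior l = {}" using division_ofD(5)[OF div] that sub by blast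
      moreover have "interior (tr k) \<subseteq> interior k" "interior (tr l) \<subseteq> interior l"
        using tr(5) that by (simp_all add: interior_mono)
      ultimately show ?thesis by blast
    qed
    have inj: "inj_on tr d'"
      using disj tr(4) by (metis Int_absorb inj_onI)
    have "tr ` d' division_of \<Union>(tr ` d')"
    proof (rule division_ofI)
      show "finite (tr ` d')" using fin' by simp
      show "K \<noteq> {}" if "K \<in> tr ` d'" for K using that tr(1) by auto
      show "\<exists>a b. K = cbox a b" if "K \<in> tr ` d'" for K using that by (auto simp: tr_def)
      show "interior K \<inter> interior L = {}" if "K \<in> tr ` d'" "L \<in> tr ` d'" "K \<noteq> L" for K L
        using that disj by blast
    qed auto
    moreover have "\<Union>(tr ` d') \<subseteq> {p..q}" using tr(6) by blast
    moreover have "(\<Sum>k\<in>tr ` d'. Sup k - Inf k) < \<delta>"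
    proof -
      have "(\<Sum>k\<in>tr ` d'. Sup k - Inf k) = (\<Sum>k\<in>d'. min (Sup k) q - max (Inf k) p)"
        using tr(2,3) by (subst sum.reindex[OF inj]) (auto intro!: sum.cong)
      also have "\<dots> \<le> (\<Sum>k\<in>d'. Sup k - Inf k)" by (intro sum_mono) auto
      also have "\<dots> \<le> (\<Sum>k\<in>d. Sup k - Inf k)"
        using division_of_real_member(2)[OF div] by (intro sum_mono2[OF fin sub]) auto
      finally show ?thesis using d by linarith
    qed
    ultimately have "(\<Sum>k\<in>tr ` d'. norm (u (Sup k) - u (Inf k))) < \<epsilon>"
      by (intro \<delta>(2)) blast
    also have "(\<Sum>k\<in>tr ` d'. norm (u (Sup k) - u (Inf k)))
        = (\<Sum>k\<in>d'. norm (u (?c (Sup k)) - u (?c (Inf k))))"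
    proof (subst sum.reindex[OF inj], rule sum.cong[OF refl])
      fix k assume k: "k \<in> d'"
      then have "max (Inf k) p < min (Sup k) q" by (simp add: d'_def)
      then have "?c (Sup k) = min (Sup k) q" "?c (Inf k) = max (Inf k) p" by linarith+
      then show "((\<lambda>k. norm (u (Sup k) - u (Inf k))) \<circ> tr) k = norm (u (?c (Sup k)) - u (?c (Inf k)))"
        unfolding comp_def tr(2,3)[OF k] by (simp only:)
    qed
    also have "\<dots> = (\<Sum>k\<in>d. norm (u (?c (Sup k)) - u (?c (Inf k))))"
    proof (rule sum.mono_neutral_left[OF fin sub], intro ballI)
      fix k assume k: "k \<in> d - d'"
      then have "\<not> max (Inf k) p < min (Sup k) q" "Inf k \<le> Sup k"
        using division_of_real_member(2)[OF div] by (auto simp: d'_def)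
      then have "?c (Sup k) = ?c (Inf k)" using \<open>p \<le> q\<close> by linarith
      then show "norm (u (?c (Sup k)) - u (?c (Inf k))) = 0" by simp
    qed
    finally show "(\<Sum>k\<in>d. norm (u (?c (Sup k)) - u (?c (Inf k)))) < \<epsilon>" .
  qed
qed

lemma absolutely_continuous_on_join:
  fixes u :: "real \<Rightarrow> 'a::euclidean_space"
  assumes "a \<le> b" "b \<le> c" "absolutely_continuous_on {a..b} u" "absolutely_continuous_on {b..c} u"
  shows "absolutely_continuous_on {a..c} u"
proof (rule absolutely_continuous_on_dominated[where C=1])
  show "absolutely_continuous_on {a..c} (\<lambda>t. u (max a (min b t)))"
    "absolutely_continuous_on {a..c} (\<lambda>t. u (max b (min c t)))"
    using absolutely_continuous_on_clip assms by blast+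
  have aux: "x \<le> y + z \<Longrightarrow> x \<le> 1 * (y + z + \<bar>r\<bar>)" for x y z r :: real
    using abs_ge_zero[of r] by (simp only: mult_1)
  fix s t assume st: "s \<in> {a..c}" "t \<in> {a..c}"
  have *: "u r = u (max a (min b r)) + u (max b (min c r)) - u b" if "r \<in> {a..c}" for r
  proof (cases "r \<le> b")
    case True
    then have "max a (min b r) = r" "max b (min c r) = b" using that assms(1,2) by auto
    then show ?thesis by simp
  next
    case False
    then have "max a (min b r) = b" "max b (min c r) = r" using that assms(1,2) by auto
    then show ?thesis by simp
  qed
  have "u t - u s = (u (max a (min b t)) - u (max a (min b s))) + (u (max b (min c t)) - u (max b (min c s)))"
    using *[OF st(1)] *[OF st(2)] by simp
  then have "norm (u t - u s) \<le> norm (u (max a (min b t)) - u (max a (min b s))) + norm (u (max b (min c t)) - u (max b (min c s)))"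
    by (metis norm_triangle_ineq)
  then show "norm (u t - u s) \<le> 1 * (norm (u (max a (min b t)) - u (max a (min b s))) + norm (u (max b (min c t)) - u (max b (min c s))) + \<bar>t - s\<bar>)"
    by (rule aux)
qed simp

lemma absolutely_continuous_on_cong:
  assumes "absolutely_continuous_on J u" "\<And>t. t \<in> J \<Longrightarrow> v t = u t"
  shows "absolutely_continuous_on J v"
  by (rule absolutely_continuous_on_dominated[OF assms(1) assms(1), where C=1]) (use assms(2) in auto)

lemma absolutely_continuous_on_shift:
  fixes u :: "real \<Rightarrow> 'a::euclidean_space"
  assumes u: "absolutely_continuous_on {a..b} u"
  shows "absolutely_continuous_on {a - c..b - c} (\<lambda>t. u (t + c))"
  unfolding absolutely_continuous_on_def
proof (intro allI impI)
  fix \<epsilon> :: real assume "\<epsilon> > 0"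
  obtain \<delta> where \<delta>: "\<delta> > 0" "\<And>d. d division_of \<Union>d \<and> \<Union>d \<subseteq> {a..b} \<and> (\<Sum>k\<in>d. Sup k - Inf k) < \<delta> \<Longrightarrow>
        (\<Sum>k\<in>d. norm (u (Sup k) - u (Inf k))) < \<epsilon>"
    using u \<open>\<epsilon> > 0\<close> unfolding absolutely_continuous_on_def by meson
  show "\<exists>\<delta>>0. \<forall>d. d division_of \<Union> d \<and> \<Union> d \<subseteq> {a - c..b - c} \<and> (\<Sum>k\<in>d. Sup k - Inf k) < \<delta> \<longrightarrow>
        (\<Sum>k\<in>d. norm (u (Sup k + c) - u (Inf k + c))) < \<epsilon>"
  proof (intro exI[of _ \<delta>] conjI allI impI \<delta>(1))
    fix d assume d: "d division_of \<Union> d \<and> \<Union> d \<subseteq> {a - c..b - c} \<and> (\<Sum>k\<in>d. Sup k - Inf k) < \<delta>"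
    then have div: "d division_of \<Union> d" by blast
    let ?T = "(`) ((+) c) :: real set \<Rightarrow> real set"
    have inj: "inj_on ?T d" by (rule inj_onI) (simp add: inj_image_eq_iff)
    have tr: "Sup (?T k) = Sup k + c" "Inf (?T k) = Inf k + c" if "k \<in> d" for k
    proof -
      note kk = division_of_real_member[OF div that]
      have "?T k = {Inf k + c..Sup k + c}"
        by (subst kk(1)) (simp add: add.commute)
      then show "Sup (?T k) = Sup k + c" "Inf (?T k) = Inf k + c" using kk(2) by simp_all
    qed
    have "?T ` d division_of \<Union>(?T ` d)"
    proof (rule division_ofI)
      show "finite (?T ` d)" using division_ofD(1)[OF div] by simp
      show "K \<noteq> {}" if "K \<in> ?T ` d" for K using that division_ofD(3)[OF div] by auto
      show "\<exists>a b. K = cbox a b" if "K \<in> ?T ` d" for K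
      proof -
        obtain k where k: "k \<in> d" "K = ?T k" using \<open>K \<in> ?T ` d\<close> by blast
        obtain a b where "k = cbox a b" using division_ofD(4)[OF div k(1)] by blast
        then show ?thesis using k by (metis cbox_translation)
      qed
      show "interior K \<inter> interior L = {}" if "K \<in> ?T ` d" "L \<in> ?T ` d" "K \<noteq> L" for K L
      proof -
        obtain k l where "k \<in> d" "l \<in> d" "K = ?T k" "L = ?T l" "k \<noteq> l" using \<open>K \<in> ?T ` d\<close> \<open>L \<in> ?T ` d\<close> \<open>K \<noteq> L\<close> by blast
        then show ?thesis using division_ofD(5)[OF div]
          by (simp add: interior_translation translation_Int[symmetric])
      qed
    qed auto
    moreover have "\<Union>(?T ` d) \<subseteq> {a..b}" using d by fastforce
    moreover have "(\<Sum>k\<in>?T ` d. Sup k - Inf k) < \<delta>"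
      using d tr by (subst sum.reindex[OF inj]) (simp add: comp_def)
    ultimately have "(\<Sum>k\<in>?T ` d. norm (u (Sup k) - u (Inf k))) < \<epsilon>" by (intro \<delta>(2)) blast
    then show "(\<Sum>k\<in>d. norm (u (Sup k + c) - u (Inf k + c))) < \<epsilon>"
      using tr by (subst (asm) sum.reindex[OF inj]) (simp add: comp_def)
  qed
qed

lemma absolutely_continuous_on_imp_continuous_on:
  fixes u :: "real \<Rightarrow> 'a::euclidean_space"
  assumes u: "absolutely_continuous_on {a..b} u"
  shows "continuous_on {a..b} u"
  unfolding continuous_on_iff
proof (intro ballI allI impI)
  fix s and \<epsilon> :: real assume s: "s \<in> {a..b}" and "\<epsilon> > 0"
  obtain \<delta> where \<delta>: "\<delta> > 0" "\<And>d. d division_of \<Union>d \<and> \<Union>d \<subseteq> {a..b} \<and> (\<Sum>k\<in>d. Sup k - Inf k) < \<delta> \<Longrightarrow>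
        (\<Sum>k\<in>d. norm (u (Sup k) - u (Inf k))) < \<epsilon>"
    using u \<open>\<epsilon> > 0\<close> unfolding absolutely_continuous_on_def by meson
  have *: "norm (u q - u p) < \<epsilon>" if "p \<in> {a..b}" "q \<in> {a..b}" "p \<le> q" "q - p < \<delta>" for p q
  proof -
    have "{{p..q}} division_of \<Union>{{p..q}}"
      using division_of_self[of p q] that by simp
    then show ?thesis using \<delta>(2)[of "{{p..q}}"] that by auto
  qed
  show "\<exists>d>0. \<forall>x'\<in>{a..b}. dist x' s < d \<longrightarrow> dist (u x') (u s) < \<epsilon>"
  proof (intro exI[of _ \<delta>] conjI ballI impI \<delta>(1))
    fix r assume "r \<in> {a..b}" "dist r s < \<delta>"
    then show "dist (u r) (u s) < \<epsilon>"
      using *[of r s] *[of s r] s by (cases "r \<le> s") (auto simp: dist_norm norm_minus_commute)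
  qed
qed

text \<open>The substitute for the fundamental theorem of calculus. Tag a division of \<open>[a,b]\<close> as in the
  Henstock integral: at a tag outside the null set the derivative bounds the increment by
  \<open>\<epsilon>\<close> times the length, and the members tagged in the null set lie in an open set of small
  measure, where absolute continuity makes the total increment small.\<close>

lemma absolutely_continuous_on_nonincreasing:
  fixes w :: "real \<Rightarrow> real"
  assumes "a \<le> b" and w: "absolutely_continuous_on {a..b} w" and N: "negligible N"
    and der: "\<And>t. t \<in> {a<..<b} - N \<Longrightarrow> \<exists>D\<le>0. (w has_real_derivative D) (at t)"
  shows "w b \<le> w a"
proof -
  define N' where "N' = insert a (insert b N)"
  have N': "negligible N'" using N by (simp add: N'_def)
  have der': "\<exists>D\<le>0. (w has_real_derivative D) (at t)" if "t \<in> {a..b} - N'" for t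
    using that der by (auto simp: N'_def)
  have main: "w b - w a \<le> \<epsilon> * (1 + (b - a))" if "\<epsilon> > 0" for \<epsilon>
  proof -
    obtain \<delta> where \<delta>: "\<delta> > 0" "\<And>d. d division_of \<Union>d \<and> \<Union>d \<subseteq> {a..b} \<and> (\<Sum>k\<in>d. Sup k - Inf k) < \<delta> \<Longrightarrow>
        (\<Sum>k\<in>d. norm (w (Sup k) - w (Inf k))) < \<epsilon>"
      using w \<open>\<epsilon> > 0\<close> unfolding absolutely_continuous_on_def by meson
    have N'0: "N' \<in> null_sets lebesgue" using N' negligible_iff_null_sets by blast
    obtain U where U: "open U" "N' \<subseteq> U" "U \<in> lmeasurable" "measure lebesgue U < \<delta>"
    proof -
      obtain U where U: "open U" "N' \<subseteq> U" "U - N' \<in> lmeasurable" "emeasure lebesgue (U - N') < ennreal \<delta>"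
        using sets_lebesgue_outer_open[of N' \<delta>] N'0 \<delta>(1) by (metis null_setsD2)
      have eq: "U = (U - N') \<union> N'" using U(2) by blast
      have e: "emeasure lebesgue U = emeasure lebesgue (U - N')"
        using U(3) N'0 by (subst eq) (rule emeasure_Un_null_set, auto)
      have 1: "U \<in> lmeasurable"
        using U(3) N'0 eq by (metis fmeasurable.Un negligible_iff_null_sets negligible_imp_measurable)
      have "emeasure lebesgue U = ennreal (measure lebesgue U)"
        using 1 by (simp add: emeasure_eq_measure2)
      then have "measure lebesgue U < \<delta>"
        using e U(4) \<delta>(1) by (metis ennreal_less_iff measure_nonneg)
      then show ?thesis using that U 1 by blast
    qed
    have loc: "\<exists>r>0. \<forall>p q. p \<le> t \<and> t \<le> q \<and> {p..q} \<subseteq> ball t r \<longrightarrow> w q - w p \<le> \<epsilon> * (q - p)"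
      if t: "t \<in> {a..b} - N'" for t
    proof -
      obtain D where D: "D \<le> 0" "(w has_real_derivative D) (at t)" using der'[OF t] by blast
      then have "(w has_derivative (*) D) (at t)" by (simp add: has_field_derivative_def)
      then obtain r where r: "r > 0" "\<And>y. norm (y - t) < r \<Longrightarrow> norm (w y - w t - D * (y - t)) \<le> \<epsilon> * norm (y - t)"
        unfolding has_derivative_at_alt using \<open>\<epsilon> > 0\<close> by meson
      show ?thesis
      proof (intro exI[of _ r] conjI r(1) allI impI)
        fix p q assume pq: "p \<le> t \<and> t \<le> q \<and> {p..q} \<subseteq> ball t r"
        then have "p \<in> ball t r" "q \<in> ball t r" by (auto simp: subset_eq)
        then have "norm (p - t) < r" "norm (q - t) < r" by (auto simp: dist_real_def abs_minus_commute)
        from r(2)[OF this(1)] r(2)[OF this(2)] pq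
        have 1: "w q - w t - D * (q - t) \<le> \<epsilon> * (q - t)" "- (w p - w t - D * (p - t)) \<le> \<epsilon> * (t - p)"
          by auto
        have "D * (q - t) \<le> 0" "D * (p - t) \<ge> 0"
          using D(1) pq by (auto simp: mult_nonpos_nonneg mult_nonpos_nonpos)
        then have "w q - w p \<le> \<epsilon> * (q - t) + \<epsilon> * (t - p)" using 1 by linarith
        then show "w q - w p \<le> \<epsilon> * (q - p)" by (simp add: algebra_simps)
      qed
    qed
    then obtain r where r: "\<And>t. t \<in> {a..b} - N' \<Longrightarrow> r t > 0"
      "\<And>t p q. t \<in> {a..b} - N' \<Longrightarrow> p \<le> t \<Longrightarrow> t \<le> q \<Longrightarrow> {p..q} \<subseteq> ball t (r t) \<Longrightarrow> w q - w p \<le> \<epsilon> * (q - p)"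
      by metis
    \<comment> \<open>The first two cases are the tags of the two kinds; outside \<open>[a,b]\<close> there are no tags and any
      open neighbourhood will do.\<close>
    define \<gamma> where "\<gamma> t = (if t \<in> N' then U else if t \<in> {a..b} then ball t (r t) else ball t 1)" for t
    have "gauge \<gamma>" unfolding gauge_def \<gamma>_def using U r(1) by auto
    then obtain P where P: "P tagged_division_of {a..b}" "\<gamma> fine P"
      using fine_division_exists_real by blast
    have finP: "finite P" using P(1) by blast
    have PD: "K = {Inf K..Sup K} \<and> Inf K \<le> Sup K \<and> t \<in> K \<and> K \<subseteq> {a..b} \<and> K \<subseteq> \<gamma> t" if "(t, K) \<in> P" for t K
    proof -
      note * = tagged_division_ofD(2,3,4)[OF P(1) that]
      then show ?thesis using fineD[OF P(2) that] by auto
    qed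
    define P1 where "P1 = {x \<in> P. fst x \<in> N'}"
    define g where "g = (\<lambda>K. if K = {} then 0 else w (Sup K) - w (Inf K))"
    have "(\<Sum>(x,K)\<in>P. g K) = (\<Sum>(x,K)\<in>P. w (Sup K) - w (Inf K))"
      by (intro sum.cong) (auto simp: g_def dest!: PD)
    then have "w b - w a = (\<Sum>(x,K)\<in>P. g K)"
      using additive_tagged_division_1[OF \<open>a \<le> b\<close> P(1), of w] by simp
    also have "\<dots> = (\<Sum>(x,K)\<in>P - P1. g K) + (\<Sum>(x,K)\<in>P1. g K)"
      using sum.subset_diff[of P1 P] finP by (auto simp: P1_def)
    also have "(\<Sum>(x,K)\<in>P - P1. g K) \<le> \<epsilon> * (b - a)"
    proof -
      have "(\<Sum>(x,K)\<in>P - P1. g K) \<le> (\<Sum>(x,K)\<in>P - P1. \<epsilon> * (Sup K - Inf K))"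
      proof (intro sum_mono, clarify)
        fix t K assume tK: "(t, K) \<in> P" "(t, K) \<notin> P1"
        note K = PD[OF tK(1)]
        then have "t \<in> {a..b}" by auto
        then have t: "t \<in> {a..b} - N'" using tK by (auto simp: P1_def)
        have tt: "Inf K \<le> t" "t \<le> Sup K" using K by (metis atLeastAtMost_iff)+
        have "K \<subseteq> ball t (r t)" using K t by (auto simp: \<gamma>_def)
        then have "{Inf K..Sup K} \<subseteq> ball t (r t)" using K by metis
        then show "g K \<le> \<epsilon> * (Sup K - Inf K)"
          unfolding g_def using r(2)[OF t tt] K by (metis empty_iff)
      qed
      also have "\<dots> \<le> (\<Sum>(x,K)\<in>P. \<epsilon> * (Sup K - Inf K))"
        using finP PD \<open>\<epsilon> > 0\<close> by (intro sum_mono2) auto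
      also have "\<dots> = \<epsilon> * (b - a)"
        using additive_tagged_division_1[OF \<open>a \<le> b\<close> P(1), of "\<lambda>t. \<epsilon> * t"]
        by (simp add: right_diff_distrib)
      finally show ?thesis .
    qed
    also have "(\<Sum>(x,K)\<in>P1. g K) \<le> \<epsilon>"
    proof -
      define d where "d = snd ` P1"
      have part: "P1 tagged_partial_division_of {a..b}"
        using P(1) tagged_partial_division_subset[of P _ P1] by (auto simp: P1_def tagged_division_of_def)
      have td: "P1 tagged_division_of \<Union>d"
        using tagged_partial_division_of_Union_self[OF part] by (simp add: d_def)
      have div: "d division_of \<Union>d" using division_of_tagged_division[OF td] by (simp add: d_def)
      have sub: "\<Union>d \<subseteq> {a..b}" "\<Union>d \<subseteq> U"
        using PD unfolding d_def P1_def \<gamma>_def by fastforce+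
      have "(\<Sum>(x,K)\<in>P1. g K) = sum g d"
        unfolding d_def
      proof (rule sum.over_tagged_division_lemma[OF td])
        fix u v :: real assume "box u v = {}"
        then show "g (cbox u v) = 0" by (cases "u = v") (auto simp: g_def)
      qed
      also have "\<dots> \<le> (\<Sum>k\<in>d. norm (w (Sup k) - w (Inf k)))"
        unfolding g_def by (intro sum_mono) auto
      also have "\<dots> < \<epsilon>"
      proof (intro \<delta>(2) conjI div sub)
        have "(\<Sum>k\<in>d. Sup k - Inf k) = (\<Sum>k\<in>d. measure lebesgue k)"
        proof (rule sum.cong[OF refl])
          fix k assume "k \<in> d"
          note k = division_of_real_member[OF div this]
          show "Sup k - Inf k = measure lebesgue k" using k(2) by (subst (3) k(1)) simp
        qed
        also have "\<dots> = measure lebesgue (\<Union>d)" by (rule content_division[OF div])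
        also have "\<dots> \<le> measure lebesgue U"
          using lmeasurable_division[OF div] U sub by (intro measure_mono_fmeasurable) auto
        finally show "(\<Sum>k\<in>d. Sup k - Inf k) < \<delta>" using U by linarith
      qed
      finally show ?thesis by simp
    qed
    finally show ?thesis by (simp add: algebra_simps)
  qed
  have "w b - w a \<le> 0"
  proof (rule field_le_epsilon)
    fix e :: real assume "e > 0"
    then show "w b - w a \<le> 0 + e" using main[of "e / (1 + (b - a))"] \<open>a \<le> b\<close> by simp
  qed
  then show ?thesis by simp
qed

section \<open>Caratheodory solutions on compact intervals\<close>

text \<open>Nothing is asked of the derivative at the two endpoints, and inside the interval it is two-sided.
  The notion is therefore stable under restriction, translation and gluing, where
  only the single point of contact is added to the exceptional set.\<close>

definition solves_on :: "(real \<Rightarrow> 'a::euclidean_space \<Rightarrow> 'a) \<Rightarrow> real \<Rightarrow> real \<Rightarrow> (real \<Rightarrow> 'a) \<Rightarrow> bool" where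
  "solves_on F a b u \<longleftrightarrow> absolutely_continuous_on {a..b} u \<and>
     (\<exists>N. negligible N \<and> (\<forall>t\<in>{a<..<b} - N. (u has_vector_derivative F t (u t)) (at t)))"

lemma solves_on_subinterval:
  assumes "solves_on F a b u" "a \<le> a'" "b' \<le> b"
  shows "solves_on F a' b' u"
  using assms absolutely_continuous_on_subset[of "{a..b}" u "{a'..b'}"]
  unfolding solves_on_def by fastforce

lemma solves_on_cong:
  assumes u: "solves_on F a b u"
    and v: "\<And>t. t \<in> {a..b} \<Longrightarrow> v t = u t" and G: "\<And>t. t \<in> {a<..<b} \<Longrightarrow> G t = F t"
  shows "solves_on G a b v"
proof -
  obtain N where N: "negligible N" "\<And>t. t \<in> {a<..<b} - N \<Longrightarrow> (u has_vector_derivative F t (u t)) (at t)"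
    using u unfolding solves_on_def by blast
  have "(v has_vector_derivative G t (v t)) (at t)" if t: "t \<in> {a<..<b} - N" for t
  proof -
    have "(u has_vector_derivative G t (v t)) (at t)"
      using N(2)[OF t] t v[of t] G[of t] by simp
    then show ?thesis
      by (rule has_vector_derivative_transform_within_open[of _ _ _ "{a<..<b}"]) (use t v in auto)
  qed
  then show ?thesis
    unfolding solves_on_def using N(1) absolutely_continuous_on_cong[of "{a..b}" u v] u v
    unfolding solves_on_def by blast
qed

lemma solves_on_shift:
  fixes u :: "real \<Rightarrow> 'a::euclidean_space"
  assumes u: "solves_on F a b u"
  shows "solves_on (\<lambda>t. F (t + c)) (a - c) (b - c) (\<lambda>t. u (t + c))"
proof -
  obtain N where N: "negligible N" "\<And>t. t \<in> {a<..<b} - N \<Longrightarrow> (u has_vector_derivative F t (u t)) (at t)"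
    using u unfolding solves_on_def by blast
  have "((\<lambda>t. u (t + c)) has_vector_derivative F (t + c) (u (t + c))) (at t)"
    if t: "t \<in> {a - c<..<b - c} - (+) (- c) ` N" for t
  proof -
    have "t + c \<notin> N" using t by (auto simp: image_iff)
    then have "(u has_vector_derivative F (t + c) (u (t + c))) (at (t + c))"
      using t by (intro N(2)) auto
    then have "(u \<circ> (\<lambda>t. t + c) has_vector_derivative 1 *\<^sub>R F (t + c) (u (t + c))) (at t)"
      by (intro vector_diff_chain_at) (auto intro!: derivative_eq_intros)
    then show ?thesis by (simp add: comp_def)
  qed
  then show ?thesis
    unfolding solves_on_def
    using absolutely_continuous_on_shift[of a b u c] negligible_translation[OF N(1), of "- c"] u
    unfolding solves_on_def by blast
qed

lemma solves_on_join:
  fixes u :: "real \<Rightarrow> 'a::euclidean_space"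
  assumes "a \<le> b" "b \<le> c" and 1: "solves_on F a b u" and 2: "solves_on F b c u"
  shows "solves_on F a c u"
proof -
  obtain N1 where N1: "negligible N1" "\<And>t. t \<in> {a<..<b} - N1 \<Longrightarrow> (u has_vector_derivative F t (u t)) (at t)"
    using 1 unfolding solves_on_def by blast
  obtain N2 where N2: "negligible N2" "\<And>t. t \<in> {b<..<c} - N2 \<Longrightarrow> (u has_vector_derivative F t (u t)) (at t)"
    using 2 unfolding solves_on_def by blast
  have "(u has_vector_derivative F t (u t)) (at t)" if "t \<in> {a<..<c} - insert b (N1 \<union> N2)" for t
    using that N1(2) N2(2) by (cases "t < b") auto
  moreover have "negligible (insert b (N1 \<union> N2))" using N1 N2 by simp
  ultimately show ?thesis
    using absolutely_continuous_on_join[OF assms(1,2)] 1 2 unfolding solves_on_def by blast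
qed

lemma solves_on_continuous_on:
  "solves_on F a b u \<Longrightarrow> continuous_on {a..b} u"
  unfolding solves_on_def using absolutely_continuous_on_imp_continuous_on by blast

text \<open>The exceptional sets of countably many compact pieces add up to a null set, so that a
  solution on a half-open interval is the same as a compatible family of solutions on compact
  intervals.\<close>

lemma carath_solution_iff_solves_on:
  fixes u :: "real \<Rightarrow> 'a::euclidean_space" and S :: "nat \<Rightarrow> real"
  assumes S: "\<And>n. S n > 0 \<and> {0..S n} \<subseteq> J" and J: "\<And>b. b \<in> J \<Longrightarrow> 0 \<le> b \<and> (\<exists>n. b < S n)"
  shows "carath_solution F J x u \<longleftrightarrow> u 0 = x \<and> (\<forall>T>0. T \<in> J \<longrightarrow> solves_on F 0 T u)"
proof
  assume c: "carath_solution F J x u"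
  then have "AE t in lebesgue. t \<in> J \<longrightarrow> (u has_vector_derivative F t (u t)) (at t within J)"
    by (simp add: carath_solution_def)
  then obtain N where N: "N \<in> null_sets lebesgue"
      "\<And>t. t \<notin> N \<Longrightarrow> t \<in> J \<Longrightarrow> (u has_vector_derivative F t (u t)) (at t within J)"
    by (auto simp: eventually_ae_filter)
  show "u 0 = x \<and> (\<forall>T>0. T \<in> J \<longrightarrow> solves_on F 0 T u)"
  proof (intro conjI allI impI)
    show "u 0 = x" using c by (simp add: carath_solution_def)
    fix T :: real assume T: "T > 0" "T \<in> J"
    obtain n where "T < S n" using J T by blast
    then have sub: "{0..T} \<subseteq> J" using S[of n] by auto
    have "(u has_vector_derivative F t (u t)) (at t)" if "t \<in> {0<..<T} - N" for t
    proof -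
      have "{0<..<T} \<subseteq> J" using sub by auto
      then have "at t within J = at t"
        using that by (metis Diff_iff at_within_open_subset open_greaterThanLessThan)
      moreover have "t \<in> J" using that sub by auto
      ultimately show ?thesis using N(2)[of t] that by auto
    qed
    then show "solves_on F 0 T u"
      using c sub N(1) unfolding solves_on_def carath_solution_def negligible_iff_null_sets by blast
  qed
next
  assume u: "u 0 = x \<and> (\<forall>T>0. T \<in> J \<longrightarrow> solves_on F 0 T u)"
  have Sn: "solves_on F 0 (S n) u" for n
  proof -
    have "S n \<in> {0..S n}" using S[of n] by simp
    then have "S n \<in> J" using S[of n] by blast
    then show ?thesis using u S[of n] by blast
  qed
  then have "\<exists>N. negligible N \<and> (\<forall>t\<in>{0<..<S n} - N. (u has_vector_derivative F t (u t)) (at t))" for n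
    unfolding solves_on_def by blast
  then obtain N where N: "\<And>n. negligible (N n)"
      "\<And>n t. t \<in> {0<..<S n} - N n \<Longrightarrow> (u has_vector_derivative F t (u t)) (at t)"
    by metis
  define M where "M = insert 0 (\<Union>n. N n)"
  have M: "negligible M" unfolding M_def using N(1)
    by (simp, intro negligible_Union_nat) auto
  have "(u has_vector_derivative F t (u t)) (at t within J)" if "t \<in> J" "t \<notin> M" for t
  proof -
    obtain n where "t < S n" using J \<open>t \<in> J\<close> by blast
    moreover have "t > 0" using J[of t] that by (auto simp: M_def less_le)
    ultimately have "(u has_vector_derivative F t (u t)) (at t)"
      using N(2)[of t n] that by (auto simp: M_def)
    then show ?thesis by (rule has_vector_derivative_at_within)
  qed
  then have "AE t in lebesgue. t \<in> J \<longrightarrow> (u has_vector_derivative F t (u t)) (at t within J)"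
    using M by (intro AE_I'[of M]) (auto simp: negligible_iff_null_sets)
  moreover have "absolutely_continuous_on {a..b} u" if "{a..b} \<subseteq> J" for a b
  proof (cases "a \<le> b")
    case True
    then have "a \<in> J" "b \<in> J" using that by auto
    then obtain n where "b < S n" "0 \<le> a" using J by blast
    then show ?thesis
      using Sn[of n] absolutely_continuous_on_subset[of "{0..S n}" u "{a..b}"] by (auto simp: solves_on_def)
  next
    case False
    then have "{a..b} \<subseteq> {0..S 0}" by simp
    then show ?thesis
      using Sn[of 0] absolutely_continuous_on_subset[of "{0..S 0}" u "{a..b}"] by (simp add: solves_on_def)
  qed
  ultimately show "carath_solution F J x u"
    using u by (simp add: carath_solution_def)
qed

lemma carath_solution_global_iff:
  "carath_solution F {0..} x u \<longleftrightarrow> u 0 = x \<and> (\<forall>T>0. solves_on F 0 T u)"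
proof -
  have ex: "\<exists>n. b < real (Suc n)" for b
  proof -
    obtain n where "b < real n" using reals_Archimedean2 by blast
    then have "b < real (Suc n)" by simp
    then show ?thesis ..
  qed
  have "carath_solution F {0..} x u \<longleftrightarrow> u 0 = x \<and> (\<forall>T>0. T \<in> {0..} \<longrightarrow> solves_on F 0 T u)"
    by (rule carath_solution_iff_solves_on[where S="\<lambda>n. real (Suc n)"]) (use ex in auto)
  then show ?thesis by simp
qed

lemma carath_solution_initial_iff:
  assumes "T > 0"
  shows "carath_solution F {0..<T} x u \<longleftrightarrow> u 0 = x \<and> (\<forall>S>0. S < T \<longrightarrow> solves_on F 0 S u)"
proof -
  have ex: "\<exists>n. b < T - T / real (n + 2)" if "b < T" for b
  proof -
    obtain n where n: "T / (T - b) < real n" using reals_Archimedean2 by blast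
    then have "T < real n * (T - b)" using that by (simp add: pos_divide_less_eq)
    also have "\<dots> \<le> real (n + 2) * (T - b)" using that by (intro mult_right_mono) auto
    finally have "T / real (n + 2) < T - b" by (simp add: pos_divide_less_eq mult.commute)
    then show ?thesis by (intro exI[of _ n]) linarith
  qed
  have pos: "T / real (n + 2) < T" "T / real (n + 2) > 0" for n
    using assms by (simp_all add: pos_divide_less_eq)
  have "carath_solution F {0..<T} x u \<longleftrightarrow> u 0 = x \<and> (\<forall>S>0. S \<in> {0..<T} \<longrightarrow> solves_on F 0 S u)"
  proof (rule carath_solution_iff_solves_on)
    show "T - T / real (n + 2) > 0 \<and> {0..T - T / real (n + 2)} \<subseteq> {0..<T}" for n
      using pos[of n] by (simp add: subset_eq)
    show "0 \<le> b \<and> (\<exists>n. b < T - T / real (n + 2))" if "b \<in> {0..<T}" for b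
      using ex[of b] that by simp
  qed
  then show ?thesis by simp
qed

text \<open>For the squared distance \<open>|u - v|\<^sup>2\<close> the product rule holds wherever both derivatives exist,
  and the weight \<open>exp (- 2 L t)\<close> absorbs the growth allowed by the Lipschitz constant \<open>L\<close>.\<close>

lemma gronwall_solves_on:
  fixes u v :: "real \<Rightarrow> 'a::euclidean_space"
  assumes "a \<le> b" "L \<ge> 0" and u: "solves_on F a b u" and v: "solves_on F a b v"
    and lip: "\<And>t. t \<in> {a<..<b} \<Longrightarrow> norm (F t (u t) - F t (v t)) \<le> L * norm (u t - v t)"
  shows "norm (u b - v b) \<le> exp (L * (b - a)) * norm (u a - v a)"
proof -
  obtain N1 where N1: "negligible N1" "\<And>t. t \<in> {a<..<b} - N1 \<Longrightarrow> (u has_vector_derivative F t (u t)) (at t)"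
    using u unfolding solves_on_def by blast
  obtain N2 where N2: "negligible N2" "\<And>t. t \<in> {a<..<b} - N2 \<Longrightarrow> (v has_vector_derivative F t (v t)) (at t)"
    using v unfolding solves_on_def by blast
  define e where "e t = exp (- 2 * L * (t - a))" for t
  define z where "z t = u t - v t" for t
  define w where "w t = e t * (z t \<bullet> z t)" for t
  have "w b \<le> w a"
  proof (rule absolutely_continuous_on_nonincreasing[OF \<open>a \<le> b\<close>])
    show "negligible (N1 \<union> N2)" using N1 N2 by simp
    fix t assume t: "t \<in> {a<..<b} - (N1 \<union> N2)"
    define z' where "z' = F t (u t) - F t (v t)"
    have z': "(z has_vector_derivative z') (at t)"
      using N1(2)[of t] N2(2)[of t] t unfolding z_def z'_def by (intro has_vector_derivative_diff) auto
    have "((\<lambda>t. z t \<bullet> z t) has_vector_derivative (z t \<bullet> z' + z' \<bullet> z t)) (at t)"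
      by (rule bounded_bilinear.has_vector_derivative[OF bounded_bilinear_inner z' z'])
    then have zz: "((\<lambda>t. z t \<bullet> z t) has_real_derivative (2 * (z t \<bullet> z'))) (at t)"
      by (simp add: has_real_derivative_iff_has_vector_derivative inner_commute)
    have "(e has_real_derivative (- 2 * L * e t)) (at t)"
      unfolding e_def by (auto intro!: derivative_eq_intros)
    from DERIV_mult[OF this zz]
    have der: "(w has_real_derivative (- 2 * L * e t * (z t \<bullet> z t) + 2 * (z t \<bullet> z') * e t)) (at t)"
      unfolding w_def .
    have "z t \<bullet> z' \<le> norm (z t) * norm z'" by (rule norm_cauchy_schwarz)
    also have "\<dots> \<le> norm (z t) * (L * norm (z t))"
      using lip[of t] t unfolding z_def z'_def by (intro mult_left_mono) auto
    also have "\<dots> = L * (z t \<bullet> z t)" by (simp add: dot_square_norm power2_eq_square)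
    finally have "e t * (z t \<bullet> z') \<le> e t * (L * (z t \<bullet> z t))"
      by (intro mult_left_mono) (auto simp: e_def)
    then have "- 2 * L * e t * (z t \<bullet> z t) + 2 * (z t \<bullet> z') * e t \<le> 0"
      by (simp add: algebra_simps)
    then show "\<exists>D\<le>0. (w has_real_derivative D) (at t)" using der by blast
  next
    have "compact (z ` {a..b})"
      unfolding z_def using solves_on_continuous_on[OF u] solves_on_continuous_on[OF v]
      by (intro compact_continuous_image continuous_intros) auto
    then obtain M where M: "M > 0" "\<And>t. t \<in> {a..b} \<Longrightarrow> norm (z t) \<le> M"
      by (metis bounded_pos compact_imp_bounded imageI)
    have z2: "z t \<bullet> z t \<le> M * M" if "t \<in> {a..b}" for t
      using M(2)[OF that] M(1) by (simp add: dot_square_norm power2_eq_square mult_mono)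
    have e01: "0 < e t" "e t \<le> 1" if "t \<in> {a..b}" for t
      using that \<open>L \<ge> 0\<close> by (auto simp: e_def)
    have elip: "\<bar>e t - e s\<bar> \<le> 2 * L * \<bar>t - s\<bar>" if "s \<in> {a..b}" "t \<in> {a..b}" for s t
    proof -
      have *: "\<bar>e t - e s\<bar> \<le> 2 * L * (t - s)" if "s \<in> {a..b}" "t \<in> {a..b}" "s \<le> t" for s t
      proof -
        have "e t = e s * exp (- 2 * L * (t - s))"
          by (simp add: e_def mult_exp_exp algebra_simps)
        then have "e s - e t = e s * (1 - exp (- 2 * L * (t - s)))" by (simp add: algebra_simps)
        moreover have "1 + (- 2 * L * (t - s)) \<le> exp (- 2 * L * (t - s))" by (rule exp_ge_add_one_self)
        moreover have "exp (- 2 * L * (t - s)) \<le> 1" using that \<open>L \<ge> 0\<close> by simp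
        ultimately have "0 \<le> e s - e t" "e s - e t \<le> 1 * (1 - exp (- 2 * L * (t - s)))"
          using e01[OF that(1)] by (simp_all add: mult_left_le_one_le)
        moreover note \<open>1 + (- 2 * L * (t - s)) \<le> exp (- 2 * L * (t - s))\<close>
        ultimately show ?thesis by simp
      qed
      show ?thesis using *[OF that] *[OF that(2,1)]
        by (cases "s \<le> t") (auto simp: abs_minus_commute)
    qed
    show "absolutely_continuous_on {a..b} w"
    proof (rule absolutely_continuous_on_dominated[where C="2 * M + 2 * L * (M * M)"])
      show "absolutely_continuous_on {a..b} u" "absolutely_continuous_on {a..b} v"
        using u v by (auto simp: solves_on_def)
      show "0 \<le> 2 * M + 2 * L * (M * M)" using M \<open>L \<ge> 0\<close> by simp
      fix s t assume st: "s \<in> {a..b}" "t \<in> {a..b}"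
      have "w t - w s = (e t - e s) * (z t \<bullet> z t) + e s * ((z t - z s) \<bullet> (z t + z s))"
        unfolding w_def by (simp add: algebra_simps inner_commute)
      then have "norm (w t - w s) \<le> \<bar>(e t - e s) * (z t \<bullet> z t)\<bar> + \<bar>e s * ((z t - z s) \<bullet> (z t + z s))\<bar>"
        by (metis abs_triangle_ineq real_norm_def)
      also have "\<bar>(e t - e s) * (z t \<bullet> z t)\<bar> \<le> (2 * L * \<bar>t - s\<bar>) * (M * M)"
        unfolding abs_mult using elip[OF st] z2[OF st(2)] \<open>L \<ge> 0\<close> by (intro mult_mono) auto
      also have "\<bar>e s * ((z t - z s) \<bullet> (z t + z s))\<bar> \<le> 1 * (norm (z t - z s) * (M + M))"
      proof -
        have "\<bar>(z t - z s) \<bullet> (z t + z s)\<bar> \<le> norm (z t - z s) * norm (z t + z s)"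
          by (rule Cauchy_Schwarz_ineq2)
        also have "\<dots> \<le> norm (z t - z s) * (M + M)"
          using M(2)[OF st(1)] M(2)[OF st(2)] norm_triangle_ineq[of "z t" "z s"] by (intro mult_left_mono) auto
        finally show ?thesis unfolding abs_mult using e01[OF st(1)] by (intro mult_mono) auto
      qed
      also have "norm (z t - z s) \<le> norm (u t - u s) + norm (v t - v s)"
        unfolding z_def using norm_triangle_ineq4[of "u t - u s" "v t - v s"] by (simp add: algebra_simps)
      finally have "norm (w t - w s) \<le> 2 * L * \<bar>t - s\<bar> * (M * M) + 1 * ((norm (u t - u s) + norm (v t - v s)) * (M + M))"
        using M(1) by (simp add: mult_right_mono)
      also have "\<dots> \<le> (2 * M + 2 * L * (M * M)) * (norm (u t - u s) + norm (v t - v s) + \<bar>t - s\<bar>)"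
      proof -
        define p q where "p = norm (u t - u s) + norm (v t - v s)" and "q = \<bar>t - s\<bar>"
        have "0 \<le> 2 * M * q" "0 \<le> 2 * L * (M * M) * p" using M(1) \<open>L \<ge> 0\<close> by (simp_all add: p_def q_def)
        then show ?thesis unfolding p_def[symmetric] q_def[symmetric] by (simp add: algebra_simps)
      qed
      finally show "norm (w t - w s) \<le> (2 * M + 2 * L * (M * M)) * (norm (u t - u s) + norm (v t - v s) + \<bar>t - s\<bar>)" .
    qed
  qed
  then have "exp (- 2 * L * (b - a)) * (norm (z b))\<^sup>2 \<le> (norm (z a))\<^sup>2"
    by (simp add: w_def e_def dot_square_norm)
  then have "exp (2 * L * (b - a)) * (exp (- 2 * L * (b - a)) * (norm (z b))\<^sup>2) \<le> exp (2 * L * (b - a)) * (norm (z a))\<^sup>2"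
    by (intro mult_left_mono) auto
  then have "(norm (z b))\<^sup>2 \<le> exp (2 * L * (b - a)) * (norm (z a))\<^sup>2"
    by (simp add: mult.assoc[symmetric] mult_exp_exp)
  also have "\<dots> = (exp (L * (b - a)) * norm (z a))\<^sup>2"
    by (simp add: power_mult_distrib exp_double[symmetric] mult.assoc)
  finally show ?thesis unfolding z_def by (rule power2_le_imp_le) simp
qed

section \<open>The flow of a single mode\<close>

lemma Sigma_classD:
  assumes "g \<in> Sigma_class"
  shows "g \<in> Lip0"
    and "\<exists>T>0. \<exists>u. carath_solution (\<lambda>_. g) {0..<T} x u"
    and "T > 0 \<Longrightarrow> carath_solution (\<lambda>_. g) {0..<T} x u \<Longrightarrow> carath_solution (\<lambda>_. g) {0..<T} x v \<Longrightarrow>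
      t \<in> {0..<T} \<Longrightarrow> u t = v t"
    and "T > 0 \<Longrightarrow> carath_solution (\<lambda>_. g) {0..<T} x u \<Longrightarrow> \<exists>v. carath_solution (\<lambda>_. g) {0..} x v"
proof -
  note * = assms[unfolded Sigma_class_def mem_Collect_eq]
  show "g \<in> Lip0" using * by (elim conjE)
  show "\<exists>T>0. \<exists>u. carath_solution (\<lambda>_. g) {0..<T} x u" using * by (elim conjE allE[of _ x])
  show "u t = v t" if "T > 0" "carath_solution (\<lambda>_. g) {0..<T} x u" "carath_solution (\<lambda>_. g) {0..<T} x v"
      "t \<in> {0..<T}"
    using *[THEN conjunct2, THEN conjunct2, THEN conjunct2, THEN conjunct1, rule_format, of T x u v t] that
    by simp
  show "\<exists>v. carath_solution (\<lambda>_. g) {0..} x v" if "T > 0" "carath_solution (\<lambda>_. g) {0..<T} x u"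
    using *[THEN conjunct2, THEN conjunct2, THEN conjunct2, THEN conjunct2, rule_format, of T x u] that
    by blast
qed

lemma Sigma_class_solution_exists:
  assumes "g \<in> Sigma_class"
  shows "\<exists>u. carath_solution (\<lambda>_. g) {0..} x u"
proof -
  obtain T u where "T > 0" "carath_solution (\<lambda>_. g) {0..<T} x u"
    using Sigma_classD(2)[OF assms, of x] by (elim exE conjE)
  then show ?thesis by (rule Sigma_classD(4)[OF assms])
qed

text \<open>Membership in \<open>Sigma_class\<close> gives uniqueness on half-open intervals; the right endpoint is
  reached by continuity.\<close>

lemma Sigma_class_solution_unique:
  fixes u v :: "real \<Rightarrow> 'a::euclidean_space"
  assumes g: "g \<in> Sigma_class" and T: "T > 0"
    and u: "solves_on (\<lambda>_. g) 0 T u" and v: "solves_on (\<lambda>_. g) 0 T v" and eq: "u 0 = v 0"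
    and t: "t \<in> {0..T}"
  shows "u t = v t"
proof -
  have c: "carath_solution (\<lambda>_. g) {0..<T} (v 0) u" "carath_solution (\<lambda>_. g) {0..<T} (v 0) v"
    using solves_on_subinterval[OF u] solves_on_subinterval[OF v] eq
    by (simp_all add: carath_solution_initial_iff[OF T])
  then have open_eq: "u s - v s = 0" if "s \<in> {0..<T}" for s
  proof -
    have "u s = v s" by (rule Sigma_classD(3)[OF g T c that])
    then show ?thesis by simp
  qed
  have cl: "closure {0..<T} = {0..T}" using T by simp
  have "continuous_on (closure {0..<T}) (\<lambda>s. u s - v s)"
    unfolding cl using solves_on_continuous_on[OF u] solves_on_continuous_on[OF v]
    by (intro continuous_on_diff)
  then have "u t - v t = 0"
    by (rule continuous_constant_on_closure[OF _ open_eq]) (use cl t in simp_all)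
  then show ?thesis by simp
qed

lemma mode_flow_eq:
  assumes g: "g \<in> Sigma_class" and u: "carath_solution (\<lambda>_. g) {0..} x u" and "t \<ge> 0"
  shows "mode_flow g t x = u t"
  unfolding flow_def
proof (rule the_equality)
  show "\<exists>v. carath_solution (\<lambda>_. g) {0..} x v \<and> v t = u t" using u by blast
  fix y assume "\<exists>v. carath_solution (\<lambda>_. g) {0..} x v \<and> v t = y"
  then obtain v where v: "carath_solution (\<lambda>_. g) {0..} x v" "v t = y" by blast
  have "v t = u t"
  proof (rule Sigma_class_solution_unique[OF g])
    show "0 < t + 1" "t \<in> {0..t + 1}" using \<open>t \<ge> 0\<close> by simp_all
    then show "solves_on (\<lambda>_. g) 0 (t + 1) v" "solves_on (\<lambda>_. g) 0 (t + 1) u" "v 0 = u 0"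
      using u v(1) unfolding carath_solution_global_iff by blast+
  qed
  then show "y = u t" using v(2) by simp
qed

lemma mode_flow_solution:
  assumes g: "g \<in> Sigma_class"
  shows "mode_flow g 0 x = x" "solves_on (\<lambda>_. g) 0 T (\<lambda>t. mode_flow g t x)"
proof -
  obtain u where u: "carath_solution (\<lambda>_. g) {0..} x u"
    using Sigma_class_solution_exists[OF g] by blast
  then have eq: "mode_flow g t x = u t" if "t \<ge> 0" for t using mode_flow_eq[OF g] that by blast
  show "mode_flow g 0 x = x" using eq[of 0] u by (simp add: carath_solution_def)
  have "solves_on (\<lambda>_. g) 0 (max T 1) u" using u by (simp add: carath_solution_global_iff)
  then have "solves_on (\<lambda>_. g) 0 (max T 1) (\<lambda>t. mode_flow g t x)"
    by (rule solves_on_cong) (use eq in auto)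
  then show "solves_on (\<lambda>_. g) 0 T (\<lambda>t. mode_flow g t x)"
    by (rule solves_on_subinterval) auto
qed

lemma solves_on_eq_mode_flow:
  assumes g: "g \<in> Sigma_class" and u: "solves_on (\<lambda>_. g) 0 T u" and "0 \<le> t" "t \<le> T"
  shows "u t = mode_flow g t (u 0)"
proof (cases "T = 0")
  case True
  then show ?thesis using assms mode_flow_solution(1)[OF g] by simp
next
  case False
  show ?thesis
  proof (rule Sigma_class_solution_unique[OF g _ u mode_flow_solution(2)[OF g]])
    show "0 < T" "t \<in> {0..T}" using False assms by auto
    show "u 0 = mode_flow g 0 (u 0)" by (simp add: mode_flow_solution(1)[OF g])
  qed
qed

lemma continuous_on_mode_flow:
  assumes g: "g \<in> Sigma_class"
  shows "continuous_on {0..T} (\<lambda>t. mode_flow g t x)"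
  using solves_on_continuous_on[OF mode_flow_solution(2)[OF g]] .

text \<open>The mode is autonomous, so a trajectory shifted in time is again a trajectory.\<close>

lemma mode_flow_add:
  assumes g: "g \<in> Sigma_class" and "s \<ge> 0" "t \<ge> 0"
  shows "mode_flow g (s + t) x = mode_flow g t (mode_flow g s x)"
proof -
  have "solves_on (\<lambda>_. g) s (s + t) (\<lambda>r. mode_flow g r x)"
    by (rule solves_on_subinterval[OF mode_flow_solution(2)[OF g, of "s + t"]]) (use assms in auto)
  from solves_on_shift[OF this, of s] have "solves_on (\<lambda>_. g) 0 t (\<lambda>r. mode_flow g (r + s) x)" by simp
  from solves_on_eq_mode_flow[OF g this, of t] show ?thesis using assms by (simp add: add.commute)
qed

text \<open>A trajectory starting close to a trajectory that stays in \<open>K\<close> cannot leave a larger set \<open>K'\<close>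
  on which the vector field is Lipschitz: up to the first time at which the two trajectories
  are \<open>\<rho>\<close> apart, the Gronwall estimate keeps them closer than \<open>\<rho>\<close>.\<close>

lemma mode_flow_gronwall:
  fixes g :: "'a::euclidean_space \<Rightarrow> 'a"
  assumes g: "g \<in> Sigma_class" and "h \<ge> 0" and L: "L-lipschitz_on K' g"
    and K: "\<And>s. s \<in> {0..h} \<Longrightarrow> mode_flow g s x \<in> K"
    and near: "\<And>y z. y \<in> K \<Longrightarrow> dist y z \<le> \<rho> \<Longrightarrow> z \<in> K'"
    and small: "exp (L * h) * norm (x - y) < \<rho>"
  shows "norm (mode_flow g h x - mode_flow g h y) \<le> exp (L * h) * norm (x - y)"
proof -
  let ?u = "\<lambda>t. mode_flow g t x" and ?v = "\<lambda>t. mode_flow g t y"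
  have L0: "L \<ge> 0" using L lipschitz_on_nonneg by blast
  have "\<rho> > 0" using small by (smt (verit) exp_ge_zero mult_nonneg_nonneg norm_ge_zero)
  have est: "norm (?u s - ?v s) \<le> exp (L * s) * norm (x - y)"
    if s: "s \<in> {0..h}" and close: "\<And>r. r \<in> {0..<s} \<Longrightarrow> dist (?u r) (?v r) \<le> \<rho>" for s
  proof -
    have "norm (?u s - ?v s) \<le> exp (L * (s - 0)) * norm (?u 0 - ?v 0)"
    proof (rule gronwall_solves_on[OF _ L0 mode_flow_solution(2)[OF g] mode_flow_solution(2)[OF g]])
      fix r assume r: "r \<in> {0<..<s}"
      then have "?u r \<in> K" using K s by auto
      then have "?u r \<in> K'" "?v r \<in> K'"
        using near[of "?u r" "?u r"] near[of "?u r" "?v r"] close[of r] r \<open>\<rho> > 0\<close> by auto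
      then show "norm (g (?u r) - g (?v r)) \<le> L * norm (?u r - ?v r)"
        using lipschitz_onD[OF L] by (simp add: dist_norm)
    qed (use s in auto)
    then show ?thesis by (simp add: mode_flow_solution(1)[OF g])
  qed
  have lt: "exp (L * s) * norm (x - y) < \<rho>" if "s \<in> {0..h}" for s
  proof -
    have "exp (L * s) * norm (x - y) \<le> exp (L * h) * norm (x - y)"
      using that L0 by (intro mult_right_mono) (auto intro: mult_left_mono)
    then show ?thesis using small by simp
  qed
  have close: "dist (?u r) (?v r) < \<rho>" if "r \<in> {0..h}" for r
  proof (rule ccontr)
    assume "\<not> dist (?u r) (?v r) < \<rho>"
    define B where "B = {0..r} \<inter> (\<lambda>r. dist (?u r) (?v r)) -` {\<rho>..}"
    have "continuous_on {0..r} (\<lambda>r. dist (?u r) (?v r))"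
      using continuous_on_mode_flow[OF g] by (intro continuous_on_dist)
    then have "closed B" unfolding B_def by (intro continuous_closed_preimage) auto
    have B: "r \<in> B" "bdd_below B" using that \<open>\<not> _\<close> by (auto simp: B_def)
    then have "Inf B \<in> B" using \<open>closed B\<close> closed_contains_Inf by blast
    then have iB: "Inf B \<in> {0..h}" "dist (?u (Inf B)) (?v (Inf B)) \<ge> \<rho>" using that by (auto simp: B_def)
    have "dist (?u q) (?v q) \<le> \<rho>" if "q \<in> {0..<Inf B}" for q
    proof -
      have "q \<notin> B" using that B cInf_lower by (meson atLeastLessThan_iff not_le)
      then show ?thesis using that \<open>Inf B \<in> B\<close> by (auto simp: B_def)
    qed
    from est[OF iB(1) this] lt[OF iB(1)] iB(2) show False by (simp add: dist_norm)
  qed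
  show ?thesis using est[of h] close \<open>h \<ge> 0\<close> by (simp add: less_imp_le)
qed

section \<open>Words of modes\<close>

text \<open>The letter \<open>(i, h)\<close> stands for running mode \<open>i\<close> during time \<open>h\<close>. Every statement about switching
  signals reduces to words, on which one can argue by induction with the flows of single modes.\<close>

fun word_flow :: "(nat \<Rightarrow> 'a::euclidean_space \<Rightarrow> 'a) \<Rightarrow> (nat \<times> real) list \<Rightarrow> 'a \<Rightarrow> 'a" where
  "word_flow f [] x = x"
| "word_flow f ((i, h) # w) x = word_flow f w (mode_flow (f i) h x)"

text \<open>Durations may vanish: the letter \<open>(j, 0)\<close> moves no point but counts as one switch.\<close>

definition words :: "nat \<Rightarrow> (nat \<times> real) list set" where
  "words m = {w. \<forall>(i, h)\<in>set w. i \<in> {1..m} \<and> 0 \<le> h}"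

definition duration :: "(nat \<times> real) list \<Rightarrow> real" where
  "duration w = sum_list (map snd w)"

lemma words_simps [simp]:
  "[] \<in> words m"
  "(i, h) # w \<in> words m \<longleftrightarrow> i \<in> {1..m} \<and> 0 \<le> h \<and> w \<in> words m"
  "v @ w \<in> words m \<longleftrightarrow> v \<in> words m \<and> w \<in> words m"
  by (auto simp: words_def)

lemma duration_simps [simp]:
  "duration [] = 0"
  "duration ((i, h) # w) = h + duration w"
  "duration (v @ w) = duration v + duration w"
  by (simp_all add: duration_def)

lemma duration_nonneg: "w \<in> words m \<Longrightarrow> duration w \<ge> 0"
  unfolding duration_def by (rule sum_list_nonneg) (auto simp: words_def)

lemma word_flow_append: "word_flow f (v @ w) x = word_flow f w (word_flow f v x)"
  by (induction v arbitrary: x) auto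

section \<open>Switching signals as words\<close>

lemma continuous_within_nat_iff:
  fixes \<sigma> :: "real \<Rightarrow> nat"
  shows "continuous (at t within A) \<sigma> \<longleftrightarrow> eventually (\<lambda>s. \<sigma> s = \<sigma> t) (at t within A)"
  by (simp add: continuous_within tendsto_discrete)

lemma signal_constant_on_segment:
  assumes \<sigma>: "\<sigma> \<in> switching_signals m" and "0 \<le> c" "c < d" and disc: "disc_points \<sigma> \<inter> {c<..<d} = {}"
    and t: "t \<in> {c..<d}"
  shows "\<sigma> t = \<sigma> c"
proof -
  have "\<sigma> constant_on {c<..<d}"
    using \<sigma> assms(2-4) unfolding switching_signals_def by blast
  then obtain k where k: "\<And>s. s \<in> {c<..<d} \<Longrightarrow> \<sigma> s = k" by (auto simp: constant_on_def)
  have "eventually (\<lambda>s. \<sigma> s = \<sigma> c) (at_right c)"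
    using \<sigma> \<open>0 \<le> c\<close> unfolding switching_signals_def continuous_within_nat_iff by blast
  moreover have "eventually (\<lambda>s. s \<in> {c<..<d}) (at_right c)"
    using \<open>c < d\<close> by (rule eventually_at_right_real)
  ultimately have "eventually (\<lambda>s. \<sigma> s = \<sigma> c \<and> s \<in> {c<..<d}) (at_right c)"
    by (rule eventually_conj)
  \<comment> \<open>By right continuity the value at \<open>c\<close> is also taken inside the open interval.\<close>
  then obtain s where "\<sigma> s = \<sigma> c" "s \<in> {c<..<d}"
    using eventually_happens'[OF trivial_limit_at_right_real] by blast
  then have "k = \<sigma> c" using k by auto
  then show ?thesis using k[of t] t by (cases "t = c") auto
qed

text \<open>On an interval without discontinuities a signal is locally constant, and intervals are connected.\<close>

lemma switching_signalsI:
  assumes range: "\<And>t. t \<ge> 0 \<Longrightarrow> \<sigma> t \<in> {1..m}"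
    and right: "\<And>t. t \<ge> 0 \<Longrightarrow> eventually (\<lambda>s. \<sigma> s = \<sigma> t) (at_right t)"
    and fin: "\<And>T. finite (disc_points \<sigma> \<inter> {0..T})"
  shows "\<sigma> \<in> switching_signals m"
proof -
  have "\<sigma> constant_on {a<..<b}" if "0 \<le> a" "a < b" and disc: "disc_points \<sigma> \<inter> {a<..<b} = {}" for a b
  proof -
    have "eventually (\<lambda>s. \<sigma> t = \<sigma> s) (at t within {a<..<b})" if "t \<in> {a<..<b}" for t
    proof -
      have "t \<notin> disc_points \<sigma>" using disc that by blast
      then have "eventually (\<lambda>s. \<sigma> s = \<sigma> t) (at t within {0..})"
        using that \<open>0 \<le> a\<close> by (simp add: disc_points_def continuous_within_nat_iff)
      then have "eventually (\<lambda>s. \<sigma> s = \<sigma> t) (at t within {a<..<b})"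
        by (rule filter_leD[rotated]) (use \<open>0 \<le> a\<close> in \<open>auto intro: at_le\<close>)
      then show ?thesis by (simp add: eq_commute)
    qed
    then have "\<sigma> s = \<sigma> t" if "s \<in> {a<..<b}" "t \<in> {a<..<b}" for s t
      using connected_local_const[of "{a<..<b}" s t \<sigma>] that connected_Ioo by blast
    then show ?thesis unfolding constant_on_def by blast
  qed
  then show ?thesis
    unfolding switching_signals_def continuous_within_nat_iff using range right fin by blast
qed

text \<open>The additional 1 is the switch that is counted by convention at time 0.\<close>

lemma num_disc_eq_Suc:
  assumes "\<sigma> \<in> switching_signals m" "T > 0"
  shows "num_disc \<sigma> 0 T = Suc (card (disc_points \<sigma> \<inter> {0<..<T}))"
proof -
  have "insert 0 (disc_points \<sigma>) \<inter> {0..<T} = insert 0 (disc_points \<sigma> \<inter> {0<..<T})"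
    using \<open>T > 0\<close> by (auto simp: less_le)
  moreover have "finite (disc_points \<sigma> \<inter> {0<..<T})"
    by (rule finite_subset[of _ "disc_points \<sigma> \<inter> {0..T}"])
      (use assms(1) in \<open>auto simp: switching_signals_def\<close>)
  ultimately show ?thesis by (simp add: num_disc_def)
qed

lemma switched_segment_unique:
  assumes g: "f (\<sigma> c) \<in> Sigma_class" and c: "0 \<le> c" "c \<le> T" and const: "\<And>t. t \<in> {c..<T} \<Longrightarrow> \<sigma> t = \<sigma> c"
    and u: "solves_on (\<lambda>t. f (\<sigma> t)) 0 T u"
  shows "u T = mode_flow (f (\<sigma> c)) (T - c) (u c)"
proof -
  have "solves_on (\<lambda>t. f (\<sigma> t)) c T u" by (rule solves_on_subinterval[OF u]) (use c in auto)
  from solves_on_shift[OF this, of c]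
  have "solves_on (\<lambda>t. f (\<sigma> (t + c))) 0 (T - c) (\<lambda>t. u (t + c))" by simp
  then have "solves_on (\<lambda>_. f (\<sigma> c)) 0 (T - c) (\<lambda>t. u (t + c))"
  proof (rule solves_on_cong)
    show "f (\<sigma> c) = f (\<sigma> (t + c))" if "t \<in> {0<..<T - c}" for t
      using const[of "t + c"] that by simp
  qed simp
  from solves_on_eq_mode_flow[OF g this, of "T - c"] c show ?thesis by simp
qed

lemma switched_segment_extend:
  assumes g: "f (\<sigma> c) \<in> Sigma_class" and c: "0 \<le> c" "c \<le> T" and const: "\<And>t. t \<in> {c..<T} \<Longrightarrow> \<sigma> t = \<sigma> c"
    and u: "solves_on (\<lambda>t. f (\<sigma> t)) 0 c u"
  shows "\<exists>v. v 0 = u 0 \<and> solves_on (\<lambda>t. f (\<sigma> t)) 0 T v"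
proof -
  define v where "v t = (if t \<le> c then u t else mode_flow (f (\<sigma> c)) (t - c) (u c))" for t
  have "solves_on (\<lambda>t. f (\<sigma> t)) 0 T v"
  proof (rule solves_on_join[OF c])
    show "solves_on (\<lambda>t. f (\<sigma> t)) 0 c v" by (rule solves_on_cong[OF u]) (auto simp: v_def)
    have "solves_on (\<lambda>_. f (\<sigma> c)) c T (\<lambda>t. mode_flow (f (\<sigma> c)) (t - c) (u c))"
      using solves_on_shift[OF mode_flow_solution(2)[OF g, of "T - c" "u c"], of "- c"] by simp
    then show "solves_on (\<lambda>t. f (\<sigma> t)) c T v"
    proof (rule solves_on_cong)
      show "v t = mode_flow (f (\<sigma> c)) (t - c) (u c)" if "t \<in> {c..T}" for t
        using that mode_flow_solution(1)[OF g, of "u c"] by (cases "t = c") (auto simp: v_def)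
      show "f (\<sigma> t) = f (\<sigma> c)" if "t \<in> {c<..<T}" for t
        using const[of t] that by simp
    qed
  qed
  moreover have "v 0 = u 0" using c by (simp add: v_def)
  ultimately show ?thesis by blast
qed

text \<open>Induction on the number of discontinuities, by splitting off the last one before \<open>T\<close>. After it
  a single mode is active, so both existence and uniqueness pass from \<open>[0,d]\<close> to \<open>[0,T]\<close> by
  following the flow of that mode.\<close>

lemma switched_system_word:
  fixes f :: "nat \<Rightarrow> 'a::euclidean_space \<Rightarrow> 'a"
  assumes f: "\<forall>i\<in>{1..m}. f i \<in> Sigma_class" and \<sigma>: "\<sigma> \<in> switching_signals m" and "T > 0"
  shows "\<exists>w\<in>words m. length w = num_disc \<sigma> 0 T \<and> duration w = T \<and>
    (\<forall>x. \<exists>u. u 0 = x \<and> solves_on (\<lambda>t. f (\<sigma> t)) 0 T u) \<and>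
    (\<forall>u. solves_on (\<lambda>t. f (\<sigma> t)) 0 T u \<longrightarrow> u T = word_flow f w (u 0))"
  using \<open>T > 0\<close>
proof (induction "num_disc \<sigma> 0 T" arbitrary: T rule: less_induct)
  case less
  define D where "D = disc_points \<sigma> \<inter> {0<..<T}"
  have finD: "finite D"
    by (rule finite_subset[of _ "disc_points \<sigma> \<inter> {0..T}"])
      (use \<sigma> in \<open>auto simp: switching_signals_def D_def\<close>)
  have mode: "\<sigma> t \<in> {1..m}" if "t \<ge> 0" for t using \<sigma> that by (auto simp: switching_signals_def)
  note num = num_disc_eq_Suc[OF \<sigma>]
  show ?case
  proof (cases "D = {}")
    case True
    have const: "\<sigma> t = \<sigma> 0" if "t \<in> {0..<T}" for t
      using signal_constant_on_segment[OF \<sigma> _ less.prems _ that] True by (simp add: D_def)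
    have g: "f (\<sigma> 0) \<in> Sigma_class" using f mode by simp
    have "\<exists>v. v 0 = x \<and> solves_on (\<lambda>t. f (\<sigma> t)) 0 T v" for x
    proof -
      have "solves_on (\<lambda>t. f (\<sigma> t)) 0 0 (\<lambda>t. mode_flow (f (\<sigma> 0)) t x)"
        by (rule solves_on_cong[OF mode_flow_solution(2)[OF g]]) auto
      from switched_segment_extend[where f=f and \<sigma>=\<sigma> and c=0, OF g order_refl less_imp_le[OF less.prems] const this]
      show ?thesis by (simp add: mode_flow_solution(1)[OF g])
    qed
    moreover have "u T = word_flow f [(\<sigma> 0, T)] (u 0)" if "solves_on (\<lambda>t. f (\<sigma> t)) 0 T u" for u
      using switched_segment_unique[where f=f and \<sigma>=\<sigma> and c=0, OF g order_refl less_imp_le[OF less.prems] const that] by simp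
    moreover have "[(\<sigma> 0, T)] \<in> words m" "length [(\<sigma> 0, T)] = num_disc \<sigma> 0 T" "duration [(\<sigma> 0, T)] = T"
      using True num[OF less.prems] less.prems mode[of 0] by (simp_all add: D_def)
    ultimately show ?thesis by (intro bexI[of _ "[(\<sigma> 0, T)]"] conjI allI impI)
  next
    case False
    define d where "d = Max D"
    have "d \<in> D" unfolding d_def using finD False by (rule Max_in)
    then have d: "0 < d" "d < T" by (auto simp: D_def)
    have last: "disc_points \<sigma> \<inter> {d<..<T} = {}"
    proof (rule ccontr)
      assume "disc_points \<sigma> \<inter> {d<..<T} \<noteq> {}"
      then obtain t where t: "t \<in> disc_points \<sigma>" "d < t" "t < T" by auto
      then have "t \<in> D" using d by (simp add: D_def)
      from Max_ge[OF finD this] t(2) show False by (simp add: d_def)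
    qed
    have "D = insert d (disc_points \<sigma> \<inter> {0<..<d})"
    proof (intro equalityI subsetI)
      fix t assume t: "t \<in> D"
      then have "\<not> d < t" using last by (auto simp: D_def)
      then show "t \<in> insert d (disc_points \<sigma> \<inter> {0<..<d})" using t by (auto simp: D_def)
    next
      fix t assume "t \<in> insert d (disc_points \<sigma> \<inter> {0<..<d})"
      then show "t \<in> D" using \<open>d \<in> D\<close> d by (auto simp: D_def)
    qed
    moreover have "finite (disc_points \<sigma> \<inter> {0<..<d})"
      by (rule finite_subset[OF _ finD]) (use d in \<open>auto simp: D_def\<close>)
    ultimately have "card D = Suc (card (disc_points \<sigma> \<inter> {0<..<d}))" by simp
    then have Suc: "num_disc \<sigma> 0 T = Suc (num_disc \<sigma> 0 d)"
      using num[OF less.prems] num[OF d(1)] by (simp add: D_def)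
    obtain w where w: "w \<in> words m" "length w = num_disc \<sigma> 0 d" "duration w = d"
      and ex: "\<And>x. \<exists>u. u 0 = x \<and> solves_on (\<lambda>t. f (\<sigma> t)) 0 d u"
      and un: "\<And>u. solves_on (\<lambda>t. f (\<sigma> t)) 0 d u \<Longrightarrow> u d = word_flow f w (u 0)"
    proof -
      have "num_disc \<sigma> 0 d < num_disc \<sigma> 0 T" using Suc by simp
      from less.hyps[OF this d(1)] show ?thesis using that by blast
    qed
    have const: "\<sigma> t = \<sigma> d" if "t \<in> {d..<T}" for t
      using signal_constant_on_segment[OF \<sigma> _ d(2) last that] d by simp
    have g: "f (\<sigma> d) \<in> Sigma_class" using f mode d by simp
    have "\<exists>v. v 0 = x \<and> solves_on (\<lambda>t. f (\<sigma> t)) 0 T v" for x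
    proof -
      obtain u where u: "u 0 = x" "solves_on (\<lambda>t. f (\<sigma> t)) 0 d u" using ex by blast
      show ?thesis
        using switched_segment_extend[where f=f and \<sigma>=\<sigma> and c=d, OF g less_imp_le[OF d(1)] less_imp_le[OF d(2)] const u(2)] u(1)
        by simp
    qed
    moreover have "u T = word_flow f (w @ [(\<sigma> d, T - d)]) (u 0)"
      if u: "solves_on (\<lambda>t. f (\<sigma> t)) 0 T u" for u
    proof -
      have "u d = word_flow f w (u 0)"
        by (rule un, rule solves_on_subinterval[OF u]) (use d in auto)
      then show ?thesis
        using switched_segment_unique[where f=f and \<sigma>=\<sigma> and c=d, OF g less_imp_le[OF d(1)] less_imp_le[OF d(2)] const u]
        by (simp add: word_flow_append)
    qed
    moreover have "w @ [(\<sigma> d, T - d)] \<in> words m" "length (w @ [(\<sigma> d, T - d)]) = num_disc \<sigma> 0 T"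
        "duration (w @ [(\<sigma> d, T - d)]) = T"
      using w Suc mode[of d] d by simp_all
    ultimately show ?thesis by (intro bexI[of _ "w @ [(\<sigma> d, T - d)]"] conjI allI impI)
  qed
qed

text \<open>Since the endpoint of every solution on \<open>[0,t]\<close> is given by a word that depends on \<open>t\<close> only, the
  solutions on different intervals are compatible, and together they form the unique global
  solution to which \<open>flow\<close> refers.\<close>

lemma switched_flow_properties:
  fixes f :: "nat \<Rightarrow> 'a::euclidean_space \<Rightarrow> 'a"
  assumes f: "\<forall>i\<in>{1..m}. f i \<in> Sigma_class" and \<sigma>: "\<sigma> \<in> switching_signals m" and "T \<ge> 0"
  shows switched_flow_eq_word_flow: "\<exists>w\<in>words m. length w = num_disc \<sigma> 0 T \<and> duration w = T \<and>
      (\<forall>x. switched_flow f \<sigma> T x = word_flow f w x)"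
    and switched_flow_solution: "switched_flow f \<sigma> 0 x = x"
      "solves_on (\<lambda>t. f (\<sigma> t)) 0 T (\<lambda>t. switched_flow f \<sigma> t x)"
    and solves_on_eq_switched_flow:
      "solves_on (\<lambda>t. f (\<sigma> t)) 0 T u \<Longrightarrow> u T = switched_flow f \<sigma> T (u 0)"
proof -
  let ?F = "\<lambda>t. f (\<sigma> t)"
  have "\<forall>T. \<exists>w. T > 0 \<longrightarrow> w \<in> words m \<and> length w = num_disc \<sigma> 0 T \<and> duration w = T \<and>
    (\<forall>x. \<exists>u. u 0 = x \<and> solves_on ?F 0 T u) \<and> (\<forall>u. solves_on ?F 0 T u \<longrightarrow> u T = word_flow f w (u 0))"
    using switched_system_word[OF f \<sigma>] by blast
  then obtain W where W: "\<And>T. T > 0 \<Longrightarrow> W T \<in> words m \<and> length (W T) = num_disc \<sigma> 0 T \<and> duration (W T) = T"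
    and ex: "\<And>T x. T > 0 \<Longrightarrow> \<exists>u. u 0 = x \<and> solves_on ?F 0 T u"
    and un: "\<And>T u. T > 0 \<Longrightarrow> solves_on ?F 0 T u \<Longrightarrow> u T = word_flow f (W T) (u 0)"
    by metis
  define U where "U x t = (if t > 0 then word_flow f (W t) x else x)" for x t
  have un': "u t = U (u 0) t" if "solves_on ?F 0 S u" "0 \<le> t" "t \<le> S" for S u t
    using un[of t u] solves_on_subinterval[OF that(1), of 0 t] that by (cases "t = 0") (auto simp: U_def)
  have U: "solves_on ?F 0 S (U x)" if S: "S > 0" for S x
  proof -
    obtain u where u: "u 0 = x" "solves_on ?F 0 S u" using ex[OF S] by blast
    show ?thesis by (rule solves_on_cong[OF u(2)]) (use un'[OF u(2)] u(1) in auto)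
  qed
  have carath: "carath_solution ?F {0..} x (U x)" for x
    using U by (simp add: carath_solution_global_iff U_def)
  have flow: "switched_flow f \<sigma> t x = U x t" if "t \<ge> 0" for t x
    unfolding flow_def
  proof (rule the_equality)
    show "\<exists>u. carath_solution ?F {0..} x u \<and> u t = U x t" using carath by blast
    fix y assume "\<exists>u. carath_solution ?F {0..} x u \<and> u t = y"
    then obtain u where u: "carath_solution ?F {0..} x u" "u t = y" by blast
    have "solves_on ?F 0 (t + 1) u" "u 0 = x"
      using u(1) that by (simp_all add: carath_solution_global_iff)
    then show "y = U x t" using un'[of "t + 1" u t] u(2) that by simp
  qed
  have num0: "num_disc \<sigma> 0 0 = 0" by (simp add: num_disc_def)
  show "\<exists>w\<in>words m. length w = num_disc \<sigma> 0 T \<and> duration w = T \<and>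
      (\<forall>x. switched_flow f \<sigma> T x = word_flow f w x)"
  proof (cases "T = 0")
    case True
    then show ?thesis using flow[of 0] num0 by (intro bexI[of _ "[]"]) (auto simp: U_def)
  next
    case False
    then show ?thesis using flow[of T] W[of T] \<open>T \<ge> 0\<close> by (intro bexI[of _ "W T"]) (auto simp: U_def)
  qed
  show "switched_flow f \<sigma> 0 x = x" using flow[of 0 x] by (simp add: U_def)
  have "solves_on ?F 0 (T + 1) (\<lambda>t. switched_flow f \<sigma> t x)"
    by (rule solves_on_cong[OF U[of "T + 1" x]]) (use flow \<open>T \<ge> 0\<close> in auto)
  then show "solves_on ?F 0 T (\<lambda>t. switched_flow f \<sigma> t x)"
    by (rule solves_on_subinterval) auto
  show "u T = switched_flow f \<sigma> T (u 0)" if "solves_on ?F 0 T u"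
    using un'[OF that \<open>T \<ge> 0\<close> order_refl] flow[OF \<open>T \<ge> 0\<close>] by simp
qed

text \<open>The signal that runs through a word. After the word has ended it stays in mode 1; the jump that
  may occur there, at time \<open>duration w\<close>, is outside the half-open interval on which
  switches are counted.\<close>

fun word_signal :: "(nat \<times> real) list \<Rightarrow> real \<Rightarrow> nat" where
  "word_signal [] t = 1"
| "word_signal ((i, h) # w) t = (if t < h then i else word_signal w (t - h))"

lemma prefixed_signal:
  fixes \<sigma> :: "real \<Rightarrow> nat"
  assumes \<sigma>: "\<sigma> \<in> switching_signals m" and i: "i \<in> {1..m}" and h: "0 \<le> h"
  defines "\<sigma>' \<equiv> \<lambda>t. if t < h then i else \<sigma> (t - h)"
  shows "\<sigma>' \<in> switching_signals m"
    and "T \<ge> 0 \<Longrightarrow> num_disc \<sigma>' 0 (h + T) \<le> Suc (num_disc \<sigma> 0 T)"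
proof -
  have disc: "h < d \<and> d - h \<in> disc_points \<sigma>" if d: "d \<in> disc_points \<sigma>'" "d \<noteq> h" for d
  proof (rule ccontr)
    assume neg: "\<not> (h < d \<and> d - h \<in> disc_points \<sigma>)"
    have "d \<ge> 0" using d by (simp add: disc_points_def)
    have "\<exists>r>0. \<forall>s\<in>{0..}. s \<noteq> d \<and> dist s d < r \<longrightarrow> \<sigma>' s = \<sigma>' d"
    proof (cases "d < h")
      case True
      then show ?thesis by (intro exI[of _ "h - d"]) (auto simp: \<sigma>'_def dist_real_def)
    next
      case False
      then have "h < d" using d by simp
      with neg have "eventually (\<lambda>s. \<sigma> s = \<sigma> (d - h)) (at (d - h) within {0..})"
        by (simp add: disc_points_def continuous_within_nat_iff)
      then obtain r where r: "r > 0"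
        "\<And>s. s \<ge> 0 \<Longrightarrow> s \<noteq> d - h \<Longrightarrow> dist s (d - h) < r \<Longrightarrow> \<sigma> s = \<sigma> (d - h)"
        unfolding eventually_at by (metis atLeast_iff)
      show ?thesis
      proof (intro exI[of _ "min r (d - h)"] conjI ballI impI)
        fix s assume "s \<in> {0..}" and s: "s \<noteq> d \<and> dist s d < min r (d - h)"
        then have "\<sigma> (s - h) = \<sigma> (d - h)" "s > h"
          by (auto intro!: r(2) simp: dist_real_def)
        then show "\<sigma>' s = \<sigma>' d" using \<open>h < d\<close> by (simp add: \<sigma>'_def)
      qed (use r \<open>h < d\<close> in auto)
    qed
    then have "eventually (\<lambda>s. \<sigma>' s = \<sigma>' d) (at d within {0..})"
      by (simp add: eventually_at)
    then show False using d by (simp add: disc_points_def continuous_within_nat_iff)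
  qed
  have fin: "finite (disc_points \<sigma> \<inter> {0..T})" for T
    using \<sigma> by (simp add: switching_signals_def)
  show "\<sigma>' \<in> switching_signals m"
  proof (rule switching_signalsI)
    fix t :: real assume "t \<ge> 0"
    have "\<sigma> (t - h) \<in> {1..m}" if "\<not> t < h"
      using \<sigma> that unfolding switching_signals_def by (simp add: image_subset_iff)
    then show "\<sigma>' t \<in> {1..m}" using i by (simp add: \<sigma>'_def)
    show "eventually (\<lambda>s. \<sigma>' s = \<sigma>' t) (at_right t)"
    proof (cases "t < h")
      case True
      then show ?thesis unfolding eventually_at_right_field by (intro exI[of _ h]) (auto simp: \<sigma>'_def)
    next
      case False
      then have "eventually (\<lambda>s. \<sigma> s = \<sigma> (t - h)) (at_right (t - h))"
        using \<sigma> unfolding switching_signals_def continuous_within_nat_iff by simp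
      then obtain b where b: "b > t - h" "\<And>s. s > t - h \<Longrightarrow> s < b \<Longrightarrow> \<sigma> s = \<sigma> (t - h)"
        unfolding eventually_at_right_field by blast
      show ?thesis
        unfolding eventually_at_right_field
        by (intro exI[of _ "b + h"]) (use b False in \<open>auto simp: \<sigma>'_def\<close>)
    qed
  next
    fix T
    have "disc_points \<sigma>' \<inter> {0..T} \<subseteq> insert h ((+) h ` (disc_points \<sigma> \<inter> {0..T}))"
    proof
      fix d assume d: "d \<in> disc_points \<sigma>' \<inter> {0..T}"
      then show "d \<in> insert h ((+) h ` (disc_points \<sigma> \<inter> {0..T}))"
        using disc[of d] h by (cases "d = h") (auto intro!: image_eqI[of _ _ "d - h"])
    qed
    then show "finite (disc_points \<sigma>' \<inter> {0..T})"
      by (rule finite_subset) (use fin in auto)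
  qed
  show "num_disc \<sigma>' 0 (h + T) \<le> Suc (num_disc \<sigma> 0 T)" if "T \<ge> 0"
  proof -
    let ?A = "insert 0 (disc_points \<sigma>) \<inter> {0..<T}"
    have finA: "finite ?A"
      by (rule finite_subset[of _ "insert 0 (disc_points \<sigma> \<inter> {0..T})"]) (use fin in auto)
    have "insert 0 (disc_points \<sigma>') \<inter> {0..<h + T} \<subseteq> insert 0 ((+) h ` ?A)"
    proof
      fix d assume d: "d \<in> insert 0 (disc_points \<sigma>') \<inter> {0..<h + T}"
      show "d \<in> insert 0 ((+) h ` ?A)"
      proof (cases "d = 0")
        case False
        then show ?thesis
          using disc[of d] d h by (cases "d = h") (auto intro!: image_eqI[of _ _ "d - h"])
      qed simp
    qed
    then have "num_disc \<sigma>' 0 (h + T) \<le> card (insert 0 ((+) h ` ?A))"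
      unfolding num_disc_def using finA by (intro card_mono) auto
    also have "\<dots> \<le> Suc (card ((+) h ` ?A))" by (rule card_insert_le_m1[of "Suc _", simplified]) simp
    also have "\<dots> \<le> Suc (card ?A)" using card_image_le[OF finA] by simp
    finally show ?thesis by (simp add: num_disc_def)
  qed
qed

text \<open>Only an inequality holds for the number of switches, since consecutive letters may have the same
  mode or vanishing duration. It goes in the useful direction: a bound that grows with the number
  of switches remains true with the length of the word.\<close>

lemma word_signal_properties:
  fixes f :: "nat \<Rightarrow> 'a::euclidean_space \<Rightarrow> 'a"
  assumes f: "\<forall>i\<in>{1..m}. f i \<in> Sigma_class" and "m \<ge> 1" and "w \<in> words m"
  shows "word_signal w \<in> switching_signals m \<and> num_disc (word_signal w) 0 (duration w) \<le> length w \<and>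
    (\<forall>x. switched_flow f (word_signal w) (duration w) x = word_flow f w x)"
  using \<open>w \<in> words m\<close>
proof (induction w)
  case Nil
  have const: "word_signal [] = (\<lambda>_. 1)" by (rule ext) simp
  have "disc_points (\<lambda>_. 1) = {}" by (simp add: disc_points_def)
  then have "word_signal [] \<in> switching_signals m"
    unfolding const using \<open>m \<ge> 1\<close> by (intro switching_signalsI) auto
  then show ?case
    using switched_flow_solution(1)[where \<sigma>="word_signal []" and T=0, OF f] by (simp add: num_disc_def const)
next
  case (Cons p w)
  obtain i h where p: "p = (i, h)" by (cases p)
  have ih: "i \<in> {1..m}" "0 \<le> h" "w \<in> words m" using Cons.prems by (simp_all add: p)
  note IH = Cons.IH[OF ih(3)]
  let ?\<sigma> = "word_signal w" and ?\<sigma>' = "word_signal (p # w)"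
  have eq: "?\<sigma>' = (\<lambda>t. if t < h then i else ?\<sigma> (t - h))" by (rule ext) (simp add: p)
  have dur: "duration w \<ge> 0" using duration_nonneg ih by blast
  have S: "?\<sigma>' \<in> switching_signals m" unfolding eq using prefixed_signal(1) IH ih by blast
  have "num_disc ?\<sigma>' 0 (h + duration w) \<le> Suc (num_disc ?\<sigma> 0 (duration w))"
    unfolding eq using prefixed_signal(2) IH ih dur by blast
  then have num: "num_disc ?\<sigma>' 0 (duration (p # w)) \<le> length (p # w)" using IH by (simp add: p)
  have "switched_flow f ?\<sigma>' (duration (p # w)) x = word_flow f (p # w) x" for x
  proof -
    let ?u = "\<lambda>t. switched_flow f ?\<sigma>' t x"
    have u: "solves_on (\<lambda>t. f (?\<sigma>' t)) 0 (h + duration w) ?u"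
      by (rule switched_flow_solution(2)[OF f S]) (use ih dur in auto)
    have "solves_on (\<lambda>t. f (?\<sigma>' t)) 0 h ?u"
      by (rule solves_on_subinterval[OF u]) (use dur in auto)
    then have "solves_on (\<lambda>_. f i) 0 h ?u"
      by (rule solves_on_cong) (auto simp: p)
    from solves_on_eq_mode_flow[OF bspec[OF f ih(1)] this, of h] ih
    have uh: "?u h = mode_flow (f i) h x" using switched_flow_solution(1)[OF f S] by simp
    have "solves_on (\<lambda>t. f (?\<sigma>' t)) h (h + duration w) ?u"
      by (rule solves_on_subinterval[OF u]) (use ih in auto)
    from solves_on_shift[OF this, of h]
    have "solves_on (\<lambda>t. f (?\<sigma>' (t + h))) 0 (duration w) (\<lambda>t. ?u (t + h))" by simp
    then have "solves_on (\<lambda>t. f (?\<sigma> t)) 0 (duration w) (\<lambda>t. ?u (t + h))"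
      by (rule solves_on_cong) (auto simp: p)
    from solves_on_eq_switched_flow[OF f _ dur this] IH
    have "?u (duration w + h) = word_flow f w (?u h)" by simp
    then show ?thesis using uh by (simp add: p add.commute)
  qed
  then show ?case using S num by blast
qed

section \<open>Functions of class K-infinity\<close>

lemma class_KinfD:
  assumes "a \<in> class_Kinf"
  shows "continuous_on {0..} a" "a 0 = 0"
    and "0 \<le> x \<Longrightarrow> 0 \<le> y \<Longrightarrow> a x < a y \<longleftrightarrow> x < y"
    and "0 \<le> x \<Longrightarrow> 0 \<le> y \<Longrightarrow> a x \<le> a y \<longleftrightarrow> x \<le> y"
    and "0 \<le> x \<Longrightarrow> 0 \<le> a x"
    and "0 < x \<Longrightarrow> 0 < a x"
proof -
  have sm: "strict_mono_on {0..} a" and "continuous_on {0..} a" and a0: "a 0 = 0"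
    using assms by (auto simp: class_Kinf_def class_K_def)
  show "continuous_on {0..} a" "a 0 = 0" by fact+
  have lt: "a x < a y \<longleftrightarrow> x < y" if "0 \<le> x" "0 \<le> y" for x y
    using strict_mono_on_less[OF sm] that by simp
  have le: "a x \<le> a y \<longleftrightarrow> x \<le> y" if "0 \<le> x" "0 \<le> y" for x y
    using strict_mono_on_less_eq[OF sm] that by simp
  show "a x < a y \<longleftrightarrow> x < y" "a x \<le> a y \<longleftrightarrow> x \<le> y" if "0 \<le> x" "0 \<le> y"
    using lt le that by blast+
  show "0 \<le> a x" if "0 \<le> x" using le[of 0 x] a0 that by simp
  show "0 < a x" if "0 < x" using lt[of 0 x] a0 that by simp
qed

lemma class_Kinf_surj:
  assumes a: "a \<in> class_Kinf" and "0 \<le> y"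
  shows "\<exists>x\<ge>0. a x = y"
proof -
  have "\<not> bounded (a ` {0..})" using a by (simp add: class_Kinf_def)
  then obtain z where z: "z \<ge> 0" "\<not> \<bar>a z\<bar> \<le> y" by (auto simp: bounded_iff)
  then have "y \<le> a z" using class_KinfD(5)[OF a z(1)] by linarith
  moreover have "continuous_on {0..z} a" by (rule continuous_on_subset[OF class_KinfD(1)[OF a]]) auto
  ultimately show ?thesis
    using IVT'[of a 0 y z] class_KinfD(2)[OF a] assms(2) z(1) by auto
qed

lemma class_KinfI:
  fixes a :: "real \<Rightarrow> real"
  assumes "continuous_on {0..} a" "a 0 = 0" "\<And>x y. 0 \<le> x \<Longrightarrow> x < y \<Longrightarrow> a x < a y"
    and "\<And>M. \<exists>x\<ge>0. a x \<ge> M"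
  shows "a \<in> class_Kinf"
proof -
  have "\<not> bounded (a ` {0..})"
  proof
    assume "bounded (a ` {0..})"
    then obtain M where M: "\<And>x. x \<ge> 0 \<Longrightarrow> \<bar>a x\<bar> \<le> M" by (auto simp: bounded_iff)
    obtain x where "x \<ge> 0" "a x \<ge> M + 1" using assms(4) by blast
    then show False using M[of x] by linarith
  qed
  then show ?thesis
    using assms(1-3) by (auto simp: class_Kinf_def class_K_def strict_mono_on_def)
qed

text \<open>Continuity of the inverse: \<open>a\<close> maps a neighbourhood \<open>(x - \<epsilon>, x + \<epsilon>)\<close> onto a neighbourhood of
  \<open>a x\<close>. At points closer than \<open>\<epsilon>\<close> to the boundary 0 the lower constraint is void.\<close>

lemma class_Kinf_inverse:
  assumes a: "a \<in> class_Kinf"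
  shows "\<exists>b\<in>class_Kinf. \<forall>x\<ge>0. b (a x) = x"
proof -
  note less = class_KinfD(3)[OF a] and le = class_KinfD(4)[OF a]
  have "\<forall>y. \<exists>x. y \<ge> 0 \<longrightarrow> x \<ge> 0 \<and> a x = y" using class_Kinf_surj[OF a] by blast
  then obtain b where b: "\<And>y. y \<ge> 0 \<Longrightarrow> b y \<ge> 0 \<and> a (b y) = y" by metis
  have ba: "b (a x) = x" if "x \<ge> 0" for x
    using b[of "a x"] class_KinfD(5)[OF a that] that le by (metis order_antisym order_refl)
  have mono: "b x < b y" if "0 \<le> x" "x < y" for x y
    using less[of "b x" "b y"] b[of x] b[of y] that by simp
  have "continuous_on {0..} b"
    unfolding continuous_on_iff
  proof (intro ballI allI impI)
    fix y \<epsilon> :: real assume y: "y \<in> {0..}" and "\<epsilon> > 0"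
    define x where "x = b y"
    have x: "x \<ge> 0" "a x = y" using b[of y] y by (simp_all add: x_def)
    define l where "l = (if x - \<epsilon> < 0 then y - 1 else a (x - \<epsilon>))"
    have l: "l < y" using x less[of "x - \<epsilon>" x] \<open>\<epsilon> > 0\<close> by (auto simp: l_def)
    have h: "y < a (x + \<epsilon>)" using x less[of x "x + \<epsilon>"] \<open>\<epsilon> > 0\<close> by simp
    show "\<exists>d>0. \<forall>x'\<in>{0..}. dist x' y < d \<longrightarrow> dist (b x') (b y) < \<epsilon>"
    proof (intro exI[of _ "min (y - l) (a (x + \<epsilon>) - y)"] conjI ballI impI)
      fix z assume z: "z \<in> {0..}" "dist z y < min (y - l) (a (x + \<epsilon>) - y)"
      then have z': "l < z" "z < a (x + \<epsilon>)" by (auto simp: dist_real_def)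
      have bz: "b z \<ge> 0" "a (b z) = z" using b z by auto
      have "b z < x + \<epsilon>" using less[of "b z" "x + \<epsilon>"] bz z' x \<open>\<epsilon> > 0\<close> by simp
      moreover have "x - \<epsilon> < b z"
      proof (cases "x - \<epsilon> < 0")
        case False
        then show ?thesis using less[of "x - \<epsilon>" "b z"] bz z' by (simp add: l_def)
      qed (use bz in linarith)
      ultimately show "dist (b z) (b y) < \<epsilon>" by (simp add: dist_real_def x_def[symmetric] abs_less_iff)
    qed (use l h in auto)
  qed
  moreover have "b 0 = 0" using ba[of 0] class_KinfD(2)[OF a] by simp
  moreover have "\<exists>x\<ge>0. b x \<ge> M" for M
    using ba[of "max M 0"] class_KinfD(5)[OF a, of "max M 0"] by (intro exI[of _ "a (max M 0)"]) auto
  ultimately have "b \<in> class_Kinf" using mono by (intro class_KinfI) auto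
  then show ?thesis using ba by blast
qed

lemma class_Kinf_cube:
  assumes a: "a \<in> class_Kinf" and "C > 0"
  shows "(\<lambda>x. C * a x ^ 3) \<in> class_Kinf"
proof (rule class_KinfI)
  show "continuous_on {0..} (\<lambda>x. C * a x ^ 3)"
    using class_KinfD(1)[OF a] by (intro continuous_intros)
  show "C * a 0 ^ 3 = 0" using class_KinfD(2)[OF a] by simp
  fix x y :: real assume "0 \<le> x" "x < y"
  then have "0 \<le> a x" "a x < a y" using class_KinfD(3,5)[OF a] by auto
  then show "C * a x ^ 3 < C * a y ^ 3" using \<open>C > 0\<close> by (simp add: power_strict_mono)
next
  fix M
  obtain x where x: "x \<ge> 0" "a x = 1 + \<bar>M\<bar> / C"
    using class_Kinf_surj[OF a, of "1 + \<bar>M\<bar> / C"] \<open>C > 0\<close> by auto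
  have "C * (1 + \<bar>M\<bar> / C) = C + \<bar>M\<bar>" using \<open>C > 0\<close> by (simp add: distrib_left)
  then have "M \<le> C * (1 + \<bar>M\<bar> / C)" using \<open>C > 0\<close> by simp
  also have "\<dots> \<le> C * (1 + \<bar>M\<bar> / C) ^ 3" using \<open>C > 0\<close> by (intro mult_left_mono self_le_power) auto
  finally show "\<exists>x\<ge>0. C * a x ^ 3 \<ge> M" using x by auto
qed

text \<open>The infimal convolution of \<open>k\<close> with the absolute value is the largest 1-Lipschitz function
  below \<open>k\<close>. Since the infimum is attained, strict monotonicity survives.\<close>

lemma class_Kinf_Lipschitz_minorant:
  assumes k: "k \<in> class_Kinf"
  shows "\<exists>g\<in>class_Kinf. (\<forall>x\<ge>0. g x \<le> k x) \<and> (\<forall>x\<ge>0. \<forall>y\<ge>0. \<bar>g x - g y\<bar> \<le> \<bar>x - y\<bar>)"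
proof -
  have "\<forall>r. \<exists>s. r \<ge> 0 \<longrightarrow> s \<in> {0..r} \<and> (\<forall>t\<in>{0..r}. k s + (r - s) \<le> k t + (r - t))"
  proof
    fix r :: real
    show "\<exists>s. r \<ge> 0 \<longrightarrow> s \<in> {0..r} \<and> (\<forall>t\<in>{0..r}. k s + (r - s) \<le> k t + (r - t))"
    proof (cases "r \<ge> 0")
      case True
      have "continuous_on {0..r} (\<lambda>s. k s + (r - s))"
        using continuous_on_subset[OF class_KinfD(1)[OF k], of "{0..r}"] by (intro continuous_intros) auto
      then show ?thesis
        using continuous_attains_inf[of "{0..r}" "\<lambda>s. k s + (r - s)"] True by auto
    qed simp
  qed
  then obtain s where s: "\<And>r. r \<ge> 0 \<Longrightarrow> s r \<in> {0..r}"
    and s_min: "\<And>r t. r \<ge> 0 \<Longrightarrow> t \<in> {0..r} \<Longrightarrow> k (s r) + (r - s r) \<le> k t + (r - t)" by metis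
  define g where "g r = k (s r) + (r - s r)" for r
  have g_le: "g r \<le> k t + (r - t)" if "0 \<le> t" "t \<le> r" for r t
    using s_min[of r t] that by (simp add: g_def)
  have mono: "g x < g y" if "0 \<le> x" "x < y" for x y
  proof (cases "s y \<le> x")
    case True
    then show ?thesis using g_le[of "s y" x] s[of y] that by (simp add: g_def)
  next
    case False
    then have "k x < k (s y)" "s y \<le> y" using class_KinfD(3)[OF k, of x "s y"] s[of y] that by auto
    then show ?thesis using g_le[of x x] that by (simp add: g_def)
  qed
  have lip: "\<bar>g x - g y\<bar> \<le> \<bar>x - y\<bar>" if "x \<ge> 0" "y \<ge> 0" for x y
  proof -
    have *: "\<bar>g x - g y\<bar> \<le> \<bar>x - y\<bar>" if "0 \<le> x" "x < y" for x y
      using mono[OF that] g_le[of "s x" y] s[of x] that by (simp add: g_def)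
    show ?thesis using *[of x y] *[of y x] that by (cases x y rule: linorder_cases) (auto simp: abs_minus_commute)
  qed
  have "g \<in> class_Kinf"
  proof (rule class_KinfI)
    have "1-lipschitz_on {0..} g" using lip by (intro lipschitz_onI) (auto simp: dist_real_def)
    then show "continuous_on {0..} g" by (rule lipschitz_on_continuous_on)
    show "g 0 = 0" using s[of 0] class_KinfD(2)[OF k] by (simp add: g_def)
    fix M
    obtain x where x: "x \<ge> 0" "k x = \<bar>M\<bar>" using class_Kinf_surj[OF k, of "\<bar>M\<bar>"] by auto
    define r where "r = x + \<bar>M\<bar>"
    have "M \<le> g r"
    proof (cases "s r \<le> x")
      case True
      then show ?thesis using class_KinfD(5)[OF k, of "s r"] s[of r] x by (simp add: g_def r_def)
    next
      case False
      then have "k x \<le> k (s r)" using class_KinfD(4)[OF k, of x "s r"] x by simp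
      moreover have "s r \<le> r" using s[of r] x by (simp add: r_def)
      ultimately show ?thesis using x abs_ge_self[of M] by (simp only: g_def)
    qed
    then show "\<exists>x\<ge>0. M \<le> g x" using x by (intro exI[of _ r]) (simp add: r_def)
  qed (use mono in auto)
  moreover have "g x \<le> k x" if "x \<ge> 0" for x using g_le[of x x] that by simp
  ultimately show ?thesis using lip by blast
qed

section \<open>Decay along a flow\<close>

lemma exp_difference_quotient_tendsto:
  "((\<lambda>h. (exp (b * h) - 1) / h) \<longlongrightarrow> b) (at_right (0::real))"
proof -
  have "((\<lambda>h. exp (b * h)) has_real_derivative b) (at 0)"
    by (auto intro!: derivative_eq_intros)
  then have "((\<lambda>h. (exp (b * h) - 1) / h) \<longlongrightarrow> b) (at 0)"
    by (simp add: DERIV_def)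
  then show ?thesis by (rule tendsto_within_subset) simp
qed

text \<open>After multiplication with \<open>exp (\<beta> * t)\<close> the claim is that a continuous function whose upper
  right Dini derivative is nonpositive does not increase. If it exceeded a line of
  slope \<open>\<epsilon>\<close>, then at the last moment at which it is below that line its difference quotients
  to the right would be larger than \<open>\<epsilon>\<close>.\<close>

lemma upper_right_Dini_decay:
  fixes \<phi> :: "real \<Rightarrow> real"
  assumes cont: "continuous_on {0..T} \<phi>" and "T \<ge> 0"
    and dini: "\<And>t. t \<in> {0..<T} \<Longrightarrow>
      Limsup (at_right 0) (\<lambda>h. ereal ((\<phi> (t + h) - \<phi> t) / h)) \<le> ereal (- \<beta> * \<phi> t)"
  shows "\<phi> T \<le> exp (- \<beta> * T) * \<phi> 0"
proof -
  define \<psi> where "\<psi> t = exp (\<beta> * t) * \<phi> t" for t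
  have main: "\<psi> T \<le> \<psi> 0 + \<epsilon> * T" if "\<epsilon> > 0" for \<epsilon>
  proof (rule ccontr)
    assume neg: "\<not> \<psi> T \<le> \<psi> 0 + \<epsilon> * T"
    define B where "B = {0..T} \<inter> (\<lambda>t. \<psi> t - \<epsilon> * t) -` {..\<psi> 0}"
    have "continuous_on {0..T} (\<lambda>t. \<psi> t - \<epsilon> * t)"
      unfolding \<psi>_def using cont by (intro continuous_intros)
    then have "closed B" unfolding B_def by (intro continuous_closed_preimage) auto
    moreover have B: "0 \<in> B" "bdd_above B" using \<open>T \<ge> 0\<close> by (auto simp: B_def)
    ultimately have "Sup B \<in> B" using closed_contains_Sup by blast
    define s where "s = Sup B"
    have s: "s \<in> {0..T}" "\<psi> s \<le> \<psi> 0 + \<epsilon> * s" using \<open>Sup B \<in> B\<close> by (auto simp: B_def s_def)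
    have "s \<noteq> T" using s neg by auto
    then have "s < T" using s by auto
    have beyond: "\<psi> t > \<psi> 0 + \<epsilon> * t" if "s < t" "t \<le> T" for t
    proof (rule ccontr)
      assume "\<not> \<psi> t > \<psi> 0 + \<epsilon> * t"
      then have "t \<in> B" using that s by (auto simp: B_def)
      from cSup_upper[OF this B(2)] \<open>s < t\<close> show False by (simp add: s_def)
    qed
    \<comment> \<open>The factor \<open>exp (- \<beta> * s)\<close> compensates the weight in \<open>\<psi>\<close>, and the 2 leaves room for
      a strict inequality in the limit.\<close>
    define \<epsilon>1 where "\<epsilon>1 = \<epsilon> * exp (- \<beta> * s) / 2"
    have "\<epsilon>1 > 0" using \<open>\<epsilon> > 0\<close> by (simp add: \<epsilon>1_def)
    have "Limsup (at_right 0) (\<lambda>h. ereal ((\<phi> (s + h) - \<phi> s) / h)) < ereal (- \<beta> * \<phi> s + \<epsilon>1)"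
      using dini[of s] s \<open>s < T\<close> \<open>\<epsilon>1 > 0\<close> by (intro order.strict_trans1[OF dini[of s]]) auto
    then have 1: "eventually (\<lambda>h. (\<phi> (s + h) - \<phi> s) / h < - \<beta> * \<phi> s + \<epsilon>1) (at_right 0)"
      using Limsup_lessD by fastforce
    have "((\<lambda>h. exp (\<beta> * s) * (exp (\<beta> * h) * (- \<beta> * \<phi> s + \<epsilon>1) + \<phi> s * ((exp (\<beta> * h) - 1) / h))) \<longlongrightarrow>
        exp (\<beta> * s) * (exp (\<beta> * 0) * (- \<beta> * \<phi> s + \<epsilon>1) + \<phi> s * \<beta>)) (at_right 0)"
      by (intro tendsto_intros exp_difference_quotient_tendsto)
    moreover have "exp (\<beta> * s) * (exp (\<beta> * 0) * (- \<beta> * \<phi> s + \<epsilon>1) + \<phi> s * \<beta>) = \<epsilon> / 2"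
      by (simp add: \<epsilon>1_def mult_exp_exp algebra_simps)
    ultimately have lim: "((\<lambda>h. exp (\<beta> * s) * (exp (\<beta> * h) * (- \<beta> * \<phi> s + \<epsilon>1)
        + \<phi> s * ((exp (\<beta> * h) - 1) / h))) \<longlongrightarrow> \<epsilon> / 2) (at_right 0)" by (simp only:)
    have 2: "eventually (\<lambda>h. exp (\<beta> * s) * (exp (\<beta> * h) * (- \<beta> * \<phi> s + \<epsilon>1)
        + \<phi> s * ((exp (\<beta> * h) - 1) / h)) < \<epsilon>) (at_right 0)"
      by (rule order_tendstoD(2)[OF lim]) (use \<open>\<epsilon> > 0\<close> in simp)
    have 3: "eventually (\<lambda>h. h \<in> {0<..<T - s}) (at_right 0)"
      using \<open>s < T\<close> by (intro eventually_at_right_real) simp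
    have "eventually (\<lambda>h. False) (at_right (0::real))"
      using 1 2 3
    proof eventually_elim
      case (elim h)
      then have h: "h > 0" "s + h \<le> T" by auto
      have "\<epsilon> * h < \<psi> (s + h) - \<psi> s" using beyond[of "s + h"] h s by (simp add: algebra_simps)
      then have "\<epsilon> < (\<psi> (s + h) - \<psi> s) / h" using h by (simp add: pos_less_divide_eq)
      also have "\<dots> = exp (\<beta> * s) * (exp (\<beta> * h) * ((\<phi> (s + h) - \<phi> s) / h) + \<phi> s * ((exp (\<beta> * h) - 1) / h))"
        using h by (simp add: \<psi>_def field_simps exp_add)
      also have "\<dots> \<le> exp (\<beta> * s) * (exp (\<beta> * h) * (- \<beta> * \<phi> s + \<epsilon>1) + \<phi> s * ((exp (\<beta> * h) - 1) / h))"
        using elim(1) by (intro mult_left_mono add_right_mono) auto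
      finally show False using elim(2) by simp
    qed
    then show False by simp
  qed
  have "\<psi> T \<le> \<psi> 0"
  proof (rule field_le_epsilon)
    fix e :: real assume "e > 0"
    have "\<psi> T \<le> \<psi> 0 + e / (T + 1) * T" using main[of "e / (T + 1)"] \<open>e > 0\<close> \<open>T \<ge> 0\<close> by simp
    also have "e / (T + 1) * T \<le> e" using \<open>e > 0\<close> \<open>T \<ge> 0\<close> by (simp add: field_simps)
    finally show "\<psi> T \<le> \<psi> 0 + e" by simp
  qed
  then have "exp (- \<beta> * T) * \<psi> T \<le> exp (- \<beta> * T) * \<psi> 0" by (intro mult_left_mono) auto
  then show ?thesis by (simp add: \<psi>_def mult.assoc[symmetric] mult_exp_exp)
qed

text \<open>The local Lipschitz condition says nothing at 0, where continuity comes from squeezing \<open>V\<close> between 0 and the upper bound.\<close>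

lemma continuous_on_sandwiched_Lip0:
  fixes V :: "'a::euclidean_space \<Rightarrow> real"
  assumes V: "V \<in> Lip0" and a: "a1 \<in> class_Kinf" "a2 \<in> class_Kinf"
    and sandwich: "\<And>x. a1 (norm x) \<le> V x \<and> V x \<le> a2 (norm x)"
  shows "continuous_on UNIV V"
proof -
  have "isCont V x" for x
  proof (cases "x = 0")
    case False
    have "continuous_on (- {0}) V"
      using local_lipschitz_continuous_on[of UNIV "- {0}" "\<lambda>_. V" 0] V by (simp add: Lip0_def)
    then show ?thesis using False by (simp add: continuous_on_eq_continuous_at open_Compl)
  next
    case True
    have "V 0 = 0" using sandwich[of 0] a by (simp add: class_KinfD(2))
    have "continuous_on UNIV (\<lambda>x::'a. a2 (norm x))"
      by (rule continuous_on_compose2[OF class_KinfD(1)[OF a(2)]]) (auto intro: continuous_intros)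
    then have "((\<lambda>x::'a. a2 (norm x)) \<longlongrightarrow> a2 (norm (0::'a))) (at 0)"
      by (meson UNIV_I continuous_on_def)
    then have "((\<lambda>x::'a. a2 (norm x)) \<longlongrightarrow> 0) (at 0)" using a by (simp add: class_KinfD(2))
    then have "(V \<longlongrightarrow> 0) (at 0)"
    proof (rule tendsto_sandwich[rotated 3])
      show "((\<lambda>_. 0) \<longlongrightarrow> (0::real)) (at (0::'a))" by simp
      show "eventually (\<lambda>x. 0 \<le> V x) (at 0)"
        using sandwich class_KinfD(5)[OF a(1)] by (intro always_eventually) (meson norm_ge_zero order_trans)
      show "eventually (\<lambda>x. V x \<le> a2 (norm x)) (at 0)"
        using sandwich by (intro always_eventually) simp
    qed
    then show ?thesis using True \<open>V 0 = 0\<close> by (simp add: isCont_def)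
  qed
  then show ?thesis by (simp add: continuous_at_imp_continuous_on)
qed

lemma Dini_decay_along_mode:
  fixes g :: "'a::euclidean_space \<Rightarrow> 'a"
  assumes g: "g \<in> Sigma_class" and V: "continuous_on UNIV V"
    and dini: "\<And>x. upper_dini g V x \<le> ereal (- \<beta> * V x)" and "h \<ge> 0"
  shows "V (mode_flow g h x) \<le> exp (- \<beta> * h) * V x"
proof -
  have "V (mode_flow g h x) \<le> exp (- \<beta> * h) * V (mode_flow g 0 x)"
  proof (rule upper_right_Dini_decay[OF _ \<open>h \<ge> 0\<close>])
    show "continuous_on {0..h} (\<lambda>t. V (mode_flow g t x))"
      by (rule continuous_on_compose2[OF V continuous_on_mode_flow[OF g]]) simp
    fix t assume t: "t \<in> {0..<h}"
    have "Limsup (at_right 0) (\<lambda>s. ereal ((V (mode_flow g (t + s) x) - V (mode_flow g t x)) / s))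
        = upper_dini g V (mode_flow g t x)"
      unfolding upper_dini_def
    proof (rule Limsup_eq)
      show "eventually (\<lambda>s. ereal ((V (mode_flow g (t + s) x) - V (mode_flow g t x)) / s)
          = ereal ((V (mode_flow g s (mode_flow g t x)) - V (mode_flow g t x)) / s)) (at_right 0)"
        using eventually_at_right_less[of "0::real"]
        by eventually_elim (use t in \<open>simp add: mode_flow_add[OF g]\<close>)
    qed
    then show "Limsup (at_right 0) (\<lambda>s. ereal ((V (mode_flow g (t + s) x) - V (mode_flow g t x)) / s))
        \<le> ereal (- \<beta> * V (mode_flow g t x))"
      using dini by simp
  qed
  then show ?thesis by (simp add: mode_flow_solution(1)[OF g])
qed

section \<open>Dependence of word flows on the initial point\<close>

text \<open>The estimate for one mode, applied letter by letter. The radius \<open>\<rho>\<close> of the tube around the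
  reference trajectory is used up only once, because the smallness assumption is made with the
  duration of the whole word.\<close>

lemma word_flow_gronwall:
  fixes f :: "nat \<Rightarrow> 'a::euclidean_space \<Rightarrow> 'a"
  assumes f: "\<forall>i\<in>{1..m}. f i \<in> Sigma_class" and L: "\<And>i. i \<in> {1..m} \<Longrightarrow> L-lipschitz_on K' (f i)"
    and near: "\<And>y z. y \<in> K \<Longrightarrow> dist y z \<le> \<rho> \<Longrightarrow> z \<in> K'" and "L \<ge> 0"
    and "w \<in> words m"
    and "\<And>v i s s' w'. w = v @ (i, s + s') # w' \<Longrightarrow> 0 \<le> s \<Longrightarrow> 0 \<le> s' \<Longrightarrow>
      mode_flow (f i) s (word_flow f v x) \<in> K"
    and "exp (L * duration w) * norm (x - y) < \<rho>"
  shows "norm (word_flow f w x - word_flow f w y) \<le> exp (L * duration w) * norm (x - y)"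
  using assms(5-)
proof (induction w arbitrary: x y)
  case Nil
  then show ?case by simp
next
  case (Cons p w)
  obtain i h where p: "p = (i, h)" by (cases p)
  have ih: "i \<in> {1..m}" "0 \<le> h" "w \<in> words m" using Cons.prems(1) by (simp_all add: p)
  have g: "f i \<in> Sigma_class" using f ih by blast
  have dur: "duration w \<ge> 0" using duration_nonneg ih(3) .
  let ?x = "mode_flow (f i) h x" and ?y = "mode_flow (f i) h y"
  have split: "exp (L * duration (p # w)) = exp (L * duration w) * exp (L * h)"
    by (simp add: p mult_exp_exp algebra_simps)
  have "exp (L * h) * norm (x - y) \<le> exp (L * duration (p # w)) * norm (x - y)"
    using dur \<open>L \<ge> 0\<close> by (intro mult_right_mono) (auto simp: p algebra_simps)
  then have small: "exp (L * h) * norm (x - y) < \<rho>" using Cons.prems(3) by linarith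
  have step: "norm (?x - ?y) \<le> exp (L * h) * norm (x - y)"
  proof (rule mode_flow_gronwall[OF g ih(2) L[OF ih(1)] _ near small])
    fix s assume "s \<in> {0..h}"
    then show "mode_flow (f i) s x \<in> K"
      using Cons.prems(2)[of "[]" i s "h - s" w] by (simp add: p)
  qed
  then have "exp (L * duration w) * norm (?x - ?y) \<le> exp (L * duration w) * (exp (L * h) * norm (x - y))"
    by (intro mult_left_mono) auto
  also have "\<dots> = exp (L * duration (p # w)) * norm (x - y)" by (simp add: split)
  finally have le: "exp (L * duration w) * norm (?x - ?y) \<le> exp (L * duration (p # w)) * norm (x - y)" .
  have "norm (word_flow f w ?x - word_flow f w ?y) \<le> exp (L * duration w) * norm (?x - ?y)"
  proof (rule Cons.IH[OF ih(3)])
    fix v j s s' w'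
    assume "w = v @ (j, s + s') # w'" "0 \<le> s" "0 \<le> s'"
    then show "mode_flow (f j) s (word_flow f v ?x) \<in> K"
      using Cons.prems(2)[of "p # v" j s s' w'] by (simp add: p)
  qed (use le Cons.prems(3) in linarith)
  then show ?case using le by (simp add: p)
qed

section \<open>The converse Lyapunov functions\<close>

text \<open>The bound on words after applying \<open>\<eta>\<^sub>1\<close> inverse and taking third powers: \<open>E\<close> plays the role of
  \<open>\<eta>\<^sub>2\<close> cubed, and \<open>g\<close> is a 1-Lipschitz function below the cube of the inverse of \<open>\<eta>\<^sub>1\<close>.\<close>

locale decaying_words =
  fixes f :: "nat \<Rightarrow> 'a::euclidean_space \<Rightarrow> 'a" and m :: nat and \<tau> \<alpha> :: real and g E :: "real \<Rightarrow> real"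
  assumes modes: "\<forall>i\<in>{1..m}. f i \<in> Sigma_class"
    and tau: "\<tau> > 0" and alpha: "\<alpha> \<ge> 0"
    and g: "g \<in> class_Kinf" and E: "E \<in> class_Kinf"
    and g_lip: "\<And>r s. r \<ge> 0 \<Longrightarrow> s \<ge> 0 \<Longrightarrow> \<bar>g r - g s\<bar> \<le> \<bar>r - s\<bar>"
    and decay: "\<And>w x. w \<in> words m \<Longrightarrow> g (norm (word_flow f w x))
      \<le> exp (3 * (\<alpha> * \<tau> * real (length w) - (1 + \<alpha>) * duration w)) * E (norm x)"
begin

text \<open>By \<open>decay\<close> a switch amplifies by at most \<open>exp (3 * \<alpha> * \<tau>)\<close>, and time contracts at the rate
  \<open>3 + 3 * \<alpha>\<close>. The Lyapunov functions penalize a switch by \<open>exp (\<beta> * \<tau>)\<close> and reward time at the rate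
  \<open>1 + \<beta> = 2 + 3 * \<alpha>\<close>, so that a factor \<open>exp (- \<tau>)\<close> per switch and a rate 1 are left over.\<close>

definition \<beta> :: real where "\<beta> = 3 * \<alpha> + 1"

text \<open>One switch is free: it is the one counted at time 0, so that a one-letter word of duration 0
  has gain \<open>g (norm x)\<close>.\<close>

definition gain :: "(nat \<times> real) list \<Rightarrow> 'a \<Rightarrow> real" where
  "gain w x = exp ((1 + \<beta>) * duration w - \<beta> * \<tau> * (real (length w) - 1)) * g (norm (word_flow f w x))"

definition starting :: "nat \<Rightarrow> (nat \<times> real) list set" where
  "starting i = {w \<in> words m. \<exists>h v. w = (i, h) # v}"

definition V :: "nat \<Rightarrow> 'a \<Rightarrow> real" where
  "V i x = (SUP w\<in>starting i. gain w x)"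

lemma beta_pos: "\<beta> > 0" using alpha by (simp add: \<beta>_def)

lemma gain_nonneg: "gain w x \<ge> 0"
  using class_KinfD(5)[OF g] by (simp add: gain_def)

text \<open>The remaining factor, exponentially small in the length and in the duration of the word, is what
  confines the words of non-negligible gain to a bounded horizon and a bounded number of switches.\<close>

lemma gain_le:
  assumes "w \<in> words m"
  shows "gain w x \<le> exp (\<beta> * \<tau> - (\<tau> * real (length w) + duration w)) * E (norm x)"
proof -
  let ?p = "(1 + \<beta>) * duration w - \<beta> * \<tau> * (real (length w) - 1)"
  have "gain w x \<le> exp ?p * (exp (3 * (\<alpha> * \<tau> * real (length w) - (1 + \<alpha>) * duration w)) * E (norm x))"
    unfolding gain_def using decay[OF assms] by (intro mult_left_mono) auto
  also have "\<dots> = exp (?p + 3 * (\<alpha> * \<tau> * real (length w) - (1 + \<alpha>) * duration w)) * E (norm x)"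
    by (simp add: exp_add mult.assoc)
  also have "?p + 3 * (\<alpha> * \<tau> * real (length w) - (1 + \<alpha>) * duration w) = \<beta> * \<tau> - (\<tau> * real (length w) + duration w)"
    by (simp add: \<beta>_def algebra_simps)
  finally show ?thesis .
qed

lemma gain_le': "w \<in> words m \<Longrightarrow> gain w x \<le> exp (\<beta> * \<tau>) * E (norm x)"
proof -
  assume w: "w \<in> words m"
  have "exp (\<beta> * \<tau> - (\<tau> * real (length w) + duration w)) * E (norm x) \<le> exp (\<beta> * \<tau>) * E (norm x)"
  proof (intro mult_right_mono)
    have "\<tau> * real (length w) \<ge> 0" using tau by simp
    then show "exp (\<beta> * \<tau> - (\<tau> * real (length w) + duration w)) \<le> exp (\<beta> * \<tau>)"
      using duration_nonneg[OF w] by simp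
  qed (use class_KinfD(5)[OF E, of "norm x"] in simp)
  then show ?thesis using gain_le[OF w, of x] by linarith
qed

lemma bdd_above_gain: "bdd_above ((\<lambda>w. gain w x) ` starting i)"
  using gain_le' by (auto simp: starting_def intro!: bdd_aboveI)

lemma gain_le_V: "w \<in> starting i \<Longrightarrow> gain w x \<le> V i x"
  unfolding V_def by (rule cSUP_upper[OF _ bdd_above_gain])

lemma V_le:
  assumes "i \<in> {1..m}" "\<And>w. w \<in> starting i \<Longrightarrow> gain w x \<le> b"
  shows "V i x \<le> b"
proof -
  have "[(i, 0)] \<in> starting i" using assms(1) by (simp add: starting_def)
  then show ?thesis unfolding V_def using assms(2) by (intro cSUP_least) auto
qed

lemma V_sandwich:
  assumes i: "i \<in> {1..m}"
  shows "g (norm x) \<le> V i x" "V i x \<le> exp (\<beta> * \<tau>) * E (norm x)"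
proof -
  have "[(i, 0)] \<in> starting i" using i by (simp add: starting_def)
  moreover have "gain [(i, 0)] x = g (norm x)"
    using mode_flow_solution(1)[OF bspec[OF modes i]] by (simp add: gain_def)
  ultimately show "g (norm x) \<le> V i x" using gain_le_V by metis
  show "V i x \<le> exp (\<beta> * \<tau>) * E (norm x)"
    using i gain_le' by (intro V_le) (auto simp: starting_def)
qed

lemma gain_append:
  "gain (v @ w) x = exp ((1 + \<beta>) * duration v - \<beta> * \<tau> * real (length v)) * gain w (word_flow f v x)"
proof -
  have "(1 + \<beta>) * duration (v @ w) - \<beta> * \<tau> * (real (length (v @ w)) - 1)
      = ((1 + \<beta>) * duration v - \<beta> * \<tau> * real (length v)) + ((1 + \<beta>) * duration w - \<beta> * \<tau> * (real (length w) - 1))"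
    by (simp add: algebra_simps)
  then show ?thesis unfolding gain_def word_flow_append by (simp only: exp_add mult.assoc)
qed

text \<open>Prolonging the first letter adds time but no switch.\<close>

lemma gain_merge:
  assumes "i \<in> {1..m}" "0 \<le> s" "0 \<le> h"
  shows "gain ((i, s + h) # w) x = exp ((1 + \<beta>) * s) * gain ((i, h) # w) (mode_flow (f i) s x)"
proof -
  have "(1 + \<beta>) * duration ((i, s + h) # w) - \<beta> * \<tau> * (real (length ((i, s + h) # w)) - 1)
      = (1 + \<beta>) * s + ((1 + \<beta>) * duration ((i, h) # w) - \<beta> * \<tau> * (real (length ((i, h) # w)) - 1))"
    by (simp add: algebra_simps)
  then show ?thesis
    unfolding gain_def using mode_flow_add[OF bspec[OF modes assms(1)] assms(2,3), of x]
    by (simp only: exp_add mult.assoc word_flow.simps)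
qed

text \<open>Each competitor for the point reached after time \<open>s\<close> in mode \<open>i\<close> is, with its first letter
  prolonged by \<open>s\<close>, a competitor for \<open>x\<close>.\<close>

lemma V_decreases:
  assumes i: "i \<in> {1..m}" and "0 \<le> s"
  shows "V i (mode_flow (f i) s x) \<le> exp (- (1 + \<beta>) * s) * V i x"
proof (rule V_le[OF i])
  fix w assume "w \<in> starting i"
  then obtain h v where w: "w = (i, h) # v" "0 \<le> h" "v \<in> words m" by (auto simp: starting_def)
  have "(i, s + h) # v \<in> starting i" using w i \<open>0 \<le> s\<close> by (auto simp: starting_def)
  then have "exp ((1 + \<beta>) * s) * gain w (mode_flow (f i) s x) \<le> V i x"
    using gain_le_V gain_merge[OF i \<open>0 \<le> s\<close> w(2)] w(1) by metis
  then have "exp (- (1 + \<beta>) * s) * (exp ((1 + \<beta>) * s) * gain w (mode_flow (f i) s x)) \<le> exp (- (1 + \<beta>) * s) * V i x"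
    by (intro mult_left_mono) auto
  also have "exp (- (1 + \<beta>) * s) * (exp ((1 + \<beta>) * s) * gain w (mode_flow (f i) s x)) = gain w (mode_flow (f i) s x)"
    by (simp add: mult.assoc[symmetric] mult_exp_exp) (simp add: algebra_simps)
  finally show "gain w (mode_flow (f i) s x) \<le> exp (- (1 + \<beta>) * s) * V i x" .
qed

text \<open>A competitor starting in mode \<open>i\<close> becomes one starting in mode \<open>j\<close> when preceded by the letter
  \<open>(j, 0)\<close>, at the price of one switch.\<close>

lemma V_switch:
  assumes i: "i \<in> {1..m}" and j: "j \<in> {1..m}"
  shows "V i x \<le> exp (\<beta> * \<tau>) * V j x"
proof (rule V_le[OF i])
  fix w assume "w \<in> starting i"
  then have "(j, 0) # w \<in> starting j" using j by (auto simp: starting_def)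
  from gain_le_V[OF this, of x] have "exp (- (\<beta> * \<tau>)) * gain w x \<le> V j x"
    using gain_append[of "[(j, 0)]" w x] mode_flow_solution(1)[OF bspec[OF modes j]] by simp
  then have "exp (\<beta> * \<tau>) * (exp (- (\<beta> * \<tau>)) * gain w x) \<le> exp (\<beta> * \<tau>) * V j x"
    by (intro mult_left_mono) auto
  then show "gain w x \<le> exp (\<beta> * \<tau>) * V j x" by (simp add: mult.assoc[symmetric] mult_exp_exp)
qed

lemma upper_dini_V:
  assumes i: "i \<in> {1..m}"
  shows "upper_dini (f i) (V i) x \<le> ereal (- (1 + \<beta>) * V i x)"
proof -
  have "upper_dini (f i) (V i) x \<le> Limsup (at_right 0) (\<lambda>h. ereal ((exp (- (1 + \<beta>) * h) - 1) / h * V i x))"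
    unfolding upper_dini_def
  proof (rule Limsup_mono)
    show "eventually (\<lambda>h. ereal ((V i (mode_flow (f i) h x) - V i x) / h)
        \<le> ereal ((exp (- (1 + \<beta>) * h) - 1) / h * V i x)) (at_right 0)"
      using eventually_at_right_less[of "0::real"]
    proof eventually_elim
      case (elim h)
      have "V i (mode_flow (f i) h x) - V i x \<le> (exp (- (1 + \<beta>) * h) - 1) * V i x"
        using V_decreases[OF i, of h x] elim by (simp add: algebra_simps)
      then have "(V i (mode_flow (f i) h x) - V i x) / h \<le> (exp (- (1 + \<beta>) * h) - 1) * V i x / h"
        using elim by (intro divide_right_mono) auto
      then show ?case by simp
    qed
  qed
  also have "\<dots> = ereal (- (1 + \<beta>) * V i x)"
    by (intro lim_imp_Limsup tendsto_ereal tendsto_mult_right exp_difference_quotient_tendsto) simp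
  finally show ?thesis .
qed

text \<open>Near \<open>x0\<close> only words with gain at least \<open>c\<close> matter, because \<open>V\<close> is at least \<open>c\<close> there. Their
  length and duration are bounded by the slack in \<open>gain_le\<close>. Hence their trajectories remain in
  a fixed annulus \<open>K\<close>: they cannot become large after few switches, and they cannot come close to 0,
  because from there the rest of the word could no longer produce a gain of size \<open>c\<close>. On a
  neighbourhood \<open>K'\<close> of the annulus, which avoids the possible singularity of the vector fields at 0,
  all modes share a Lipschitz constant, and the Gronwall estimate over the bounded horizon
  makes the gains Lipschitz with a constant independent of the word.\<close>

lemma V_locally_Lipschitz:
  assumes "x0 \<noteq> 0"
  shows "\<exists>u>0. \<exists>M\<ge>0. \<forall>i\<in>{1..m}. \<forall>x\<in>cball x0 u. \<forall>y\<in>cball x0 u. V i x \<le> V i y + M * norm (x - y)"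
proof -
  define r where "r = norm x0 / 2"
  have r: "r > 0" using assms by (simp add: r_def)
  have annulus: "r \<le> norm x \<and> norm x \<le> 3 * r" if "dist x0 x \<le> r" for x
    using that norm_triangle_ineq2[of x0 x] norm_triangle_ineq2[of x x0]
    by (simp add: r_def dist_norm norm_minus_commute)
  define c where "c = g r"
  have c: "c > 0" using class_KinfD(6)[OF g r] by (simp add: c_def)
  define E0 where "E0 = E (3 * r)"
  have E0: "E0 > 0" using class_KinfD(6)[OF E, of "3 * r"] r by (simp add: E0_def)
  define A where "A = \<beta> * \<tau>"
  have A: "A > 0" using beta_pos tau by (simp add: A_def)
  define Q where "Q = max 0 (ln (exp A * E0 / c))"
  have Q: "\<tau> * real (length w) + duration w \<le> Q"
    if "w \<in> words m" "c \<le> gain w x" "norm x \<le> 3 * r" for w x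
  proof -
    let ?q = "\<tau> * real (length w) + duration w"
    have "E (norm x) \<le> E0" using class_KinfD(4)[OF E, of "norm x" "3 * r"] that(3) r by (simp add: E0_def)
    then have "exp (A - ?q) * E (norm x) \<le> exp (A - ?q) * E0" by (intro mult_left_mono) auto
    with gain_le[OF that(1), of x] that(2) have "c \<le> exp (A - ?q) * E0"
      unfolding A_def by linarith
    then have "exp ?q * c \<le> exp ?q * (exp (A - ?q) * E0)" by (intro mult_left_mono) auto
    also have "\<dots> = exp A * E0" by (simp add: mult.assoc[symmetric] mult_exp_exp)
    finally have "exp ?q \<le> exp A * E0 / c" using c by (simp add: pos_le_divide_eq)
    then have "?q \<le> ln (exp A * E0 / c)" using c E0 by (subst ln_ge_iff) auto
    then show ?thesis by (simp add: Q_def)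
  qed
  have Q0: "Q \<ge> 0" by (simp add: Q_def)
  define c' where "c' = c * exp (- (A + (1 + \<beta>) * Q))"
  have c': "c' > 0" using c by (simp add: c'_def)
  obtain \<delta> where \<delta>: "\<delta> \<ge> 0" "E \<delta> = c'" using class_Kinf_surj[OF E, of c'] c' by auto
  have "\<delta> > 0" using \<delta> c' class_KinfD(2)[OF E] by (cases "\<delta> = 0") auto
  \<comment> \<open>The additional \<open>\<tau>\<close> accounts for the letter that is cut in two at the intermediate time.\<close>
  define b where "b = exp (3 * \<alpha> * (Q + \<tau>)) * E0"
  obtain R where R: "R \<ge> 0" "g R = b" using class_Kinf_surj[OF g, of b] E0 by (auto simp: b_def)
  define K where "K = {z::'a. \<delta> \<le> norm z \<and> norm z \<le> R}"
  define K' where "K' = {z::'a. \<delta> / 2 \<le> norm z \<and> norm z \<le> R + \<delta> / 2}"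
  have near: "z \<in> K'" if "y \<in> K" "dist y z \<le> \<delta> / 2" for y z
    using that norm_triangle_ineq2[of y z] norm_triangle_ineq2[of z y]
    by (auto simp: K_def K'_def dist_norm norm_minus_commute)
  have path: "mode_flow (f i) s (word_flow f v x) \<in> K"
    if w: "v @ (i, s + s') # w' \<in> words m" (is "?w \<in> _") and s: "0 \<le> s" "0 \<le> s'"
      and large: "c \<le> gain (v @ (i, s + s') # w') x" and x: "norm x \<le> 3 * r" for v i s s' w' x
  proof -
    have i: "i \<in> {1..m}" and v: "v \<in> words m" and w': "w' \<in> words m" using w by auto
    define z where "z = mode_flow (f i) s (word_flow f v x)"
    have z: "z = word_flow f (v @ [(i, s)]) x" by (simp add: z_def word_flow_append)
    have "\<tau> * real (length ?w) + duration ?w \<le> Q" using Q[OF w large x] .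
    moreover have "\<tau> * real (length ?w) \<ge> \<tau> * real (length v)" using tau by (intro mult_left_mono) auto
    moreover have "\<tau> * real (length v) \<ge> 0" using tau by simp
    moreover have dv: "duration v \<ge> 0" "duration w' \<ge> 0" using duration_nonneg v w' by blast+
    ultimately have lv: "\<tau> * real (length v) \<le> Q" and dvs: "duration v + s \<le> Q"
      using s by simp_all
    have "E (norm x) \<le> E0" using class_KinfD(4)[OF E, of "norm x" "3 * r"] x r by (simp add: E0_def)
    \<comment> \<open>upper bound on the radius\<close>
    have "3 * (\<alpha> * \<tau> * real (length (v @ [(i, s)])) - (1 + \<alpha>) * duration (v @ [(i, s)])) \<le> 3 * \<alpha> * (Q + \<tau>)"
    proof -
      have "\<alpha> * (\<tau> * real (length v)) \<le> \<alpha> * Q" using alpha lv by (rule mult_left_mono[rotated])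
      moreover have "(1 + \<alpha>) * (duration v + s) \<ge> 0" using alpha dv s by simp
      ultimately show ?thesis by (simp add: algebra_simps)
    qed
    then have "exp (3 * (\<alpha> * \<tau> * real (length (v @ [(i, s)])) - (1 + \<alpha>) * duration (v @ [(i, s)]))) * E (norm x) \<le> b"
      unfolding b_def using \<open>E (norm x) \<le> E0\<close> class_KinfD(5)[OF E, of "norm x"] by (intro mult_mono) auto
    moreover have "v @ [(i, s)] \<in> words m" using v i s by simp
    ultimately have "g (norm z) \<le> g R" using decay[of "v @ [(i, s)]" x] unfolding z R(2) by linarith
    then have upper: "norm z \<le> R" using class_KinfD(4)[OF g] R(1) by simp
    \<comment> \<open>lower bound on the radius\<close>
    have "gain ?w x = exp ((1 + \<beta>) * duration v - A * real (length v)) *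
        (exp ((1 + \<beta>) * s) * gain ((i, s') # w') z)"
      unfolding gain_append z_def A_def by (simp only: gain_merge[OF i s])
    also have "\<dots> = exp ((1 + \<beta>) * (duration v + s) - A * real (length v)) * gain ((i, s') # w') z"
      by (simp only: mult.assoc[symmetric] mult_exp_exp) (simp add: algebra_simps)
    also have "\<dots> \<le> exp ((1 + \<beta>) * Q) * (exp A * E (norm z))"
    proof (rule mult_mono)
      have "(1 + \<beta>) * (duration v + s) \<le> (1 + \<beta>) * Q" using beta_pos dvs by (intro mult_left_mono) auto
      moreover have "A * real (length v) \<ge> 0" using A by simp
      ultimately show "exp ((1 + \<beta>) * (duration v + s) - A * real (length v)) \<le> exp ((1 + \<beta>) * Q)" by simp
      show "gain ((i, s') # w') z \<le> exp A * E (norm z)"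
        unfolding A_def using i s w' by (intro gain_le') simp
    qed (use gain_nonneg in auto)
    finally have "c \<le> exp (A + (1 + \<beta>) * Q) * E (norm z)"
      using large by (simp add: exp_add mult_ac)
    then have "exp (- (A + (1 + \<beta>) * Q)) * c \<le> exp (- (A + (1 + \<beta>) * Q)) * (exp (A + (1 + \<beta>) * Q) * E (norm z))"
      by (intro mult_left_mono) auto
    also have "\<dots> = E (norm z)" by (simp only: mult.assoc[symmetric] mult_exp_exp) simp
    finally have "E \<delta> \<le> E (norm z)" by (simp add: \<delta>(2) c'_def mult.commute)
    then have "\<delta> \<le> norm z" using class_KinfD(4)[OF E] \<delta>(1) by simp
    then show ?thesis using upper by (simp add: K_def z_def)
  qed
  have "\<exists>L. L-lipschitz_on K' (f i)" if "i \<in> {1..m}" for i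
  proof -
    have "closed K'" unfolding K'_def by (intro closed_Collect_conj closed_Collect_le continuous_intros)
    moreover have "bounded K'" unfolding bounded_iff K'_def by auto
    ultimately have "compact K'" by (simp add: compact_eq_bounded_closed)
    moreover have "local_lipschitz UNIV (- {0}) (\<lambda>_::real. f i)"
      using bspec[OF modes that] Sigma_classD(1) unfolding Lip0_def by blast
    then have "local_lipschitz {0::real} K' (\<lambda>_. f i)"
      by (rule local_lipschitz_subset) (use \<open>\<delta> > 0\<close> in \<open>auto simp: K'_def\<close>)
    ultimately show ?thesis
      using local_lipschitz_compact_implies_lipschitz[of "{0::real}" K' "\<lambda>_. f i"] by auto
  qed
  then obtain l where l: "\<And>i. i \<in> {1..m} \<Longrightarrow> (l i)-lipschitz_on K' (f i)" by metis
  define L where "L = (\<Sum>i\<in>{1..m}. l i)"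
  have l0: "l i \<ge> 0" if "i \<in> {1..m}" for i using l[OF that] lipschitz_on_nonneg by blast
  have L: "L-lipschitz_on K' (f i)" if i: "i \<in> {1..m}" for i
  proof -
    have "l i \<le> L" unfolding L_def by (rule member_le_sum[OF i]) (use l0 in auto)
    then show ?thesis by (rule lipschitz_on_le[OF l[OF i]])
  qed
  have L0: "L \<ge> 0" unfolding L_def using l0 by (intro sum_nonneg)
  define M where "M = exp ((1 + \<beta>) * Q + A) * exp (L * Q)"
  \<comment> \<open>Two points of the ball are at most \<open>2 * u\<close> apart; the denominator 8 keeps the amplified
    distance below \<open>\<delta> / 2\<close>, which is the distance from \<open>K\<close> within which \<open>K'\<close> is guaranteed.\<close>
  define u where "u = min r (\<delta> / (8 * exp (L * Q)))"
  have u: "u > 0" using r \<open>\<delta> > 0\<close> by (simp add: u_def)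
  have close: "gain w x \<le> gain w y + M * norm (x - y)"
    if w: "w \<in> words m" and large: "c \<le> gain w x" and xy: "x \<in> cball x0 u" "y \<in> cball x0 u" for w x y
  proof -
    have x: "norm x \<le> 3 * r" using annulus[of x] xy by (simp add: u_def)
    have dur: "duration w \<le> Q"
    proof -
      have "\<tau> * real (length w) \<ge> 0" using tau by simp
      then show ?thesis using Q[OF w large x] by linarith
    qed
    have eL: "exp (L * duration w) \<le> exp (L * Q)" using dur L0 by (simp add: mult_left_mono)
    have "norm (x - y) \<le> 2 * u"
      using xy dist_triangle3[of x y x0] by (simp add: dist_norm)
    also have "\<dots> \<le> 2 * (\<delta> / (8 * exp (L * Q)))" by (simp add: u_def)
    finally have "exp (L * Q) * norm (x - y) \<le> exp (L * Q) * (2 * (\<delta> / (8 * exp (L * Q))))"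
      by (intro mult_left_mono) auto
    also have "\<dots> = \<delta> / 4" by simp
    finally have "exp (L * Q) * norm (x - y) < \<delta> / 2" using \<open>\<delta> > 0\<close> by linarith
    moreover have "exp (L * duration w) * norm (x - y) \<le> exp (L * Q) * norm (x - y)"
      using eL by (intro mult_right_mono) auto
    ultimately have small: "exp (L * duration w) * norm (x - y) < \<delta> / 2"
      and eq: "exp (L * duration w) * norm (x - y) \<le> exp (L * Q) * norm (x - y)" by linarith+
    have "norm (word_flow f w x - word_flow f w y) \<le> exp (L * duration w) * norm (x - y)"
    proof (rule word_flow_gronwall[OF modes L near L0 w _ small])
      fix v i s s' w' assume ww: "w = v @ (i, s + s') # w'" "0 \<le> s" "0 \<le> s'"
      show "mode_flow (f i) s (word_flow f v x) \<in> K"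
        by (rule path[of v i s s' w' x]) (use w large x ww in simp_all)
    qed
    then have flows: "norm (word_flow f w x - word_flow f w y) \<le> exp (L * Q) * norm (x - y)"
      using eq by linarith
    let ?p = "(1 + \<beta>) * duration w - A * (real (length w) - 1)"
    have "?p \<le> (1 + \<beta>) * Q + A"
    proof -
      have "(1 + \<beta>) * duration w \<le> (1 + \<beta>) * Q" using beta_pos dur by (intro mult_left_mono) auto
      moreover have "A * real (length w) \<ge> 0" using A by simp
      ultimately show ?thesis by (simp add: right_diff_distrib)
    qed
    then have p: "exp ?p \<le> exp ((1 + \<beta>) * Q + A)" by simp
    have "gain w x - gain w y = exp ?p * (g (norm (word_flow f w x)) - g (norm (word_flow f w y)))"
      by (simp add: gain_def A_def right_diff_distrib)
    also have "\<dots> \<le> exp ?p * norm (word_flow f w x - word_flow f w y)"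
    proof (intro mult_left_mono)
      have "\<bar>g (norm (word_flow f w x)) - g (norm (word_flow f w y))\<bar> \<le> \<bar>norm (word_flow f w x) - norm (word_flow f w y)\<bar>"
        by (rule g_lip) auto
      also have "\<dots> \<le> norm (word_flow f w x - word_flow f w y)" by (rule norm_triangle_ineq3)
      finally show "g (norm (word_flow f w x)) - g (norm (word_flow f w y)) \<le> norm (word_flow f w x - word_flow f w y)"
        by linarith
    qed simp
    also have "\<dots> \<le> exp ((1 + \<beta>) * Q + A) * (exp (L * Q) * norm (x - y))"
      using p flows by (intro mult_mono) auto
    finally show ?thesis by (simp add: M_def mult.assoc)
  qed
  have "V i x \<le> V i y + M * norm (x - y)"
    if i: "i \<in> {1..m}" and xy: "x \<in> cball x0 u" "y \<in> cball x0 u" for i x y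
  proof (rule V_le[OF i])
    fix w assume w: "w \<in> starting i"
    show "gain w x \<le> V i y + M * norm (x - y)"
    proof (cases "c \<le> gain w x")
      case True
      then show ?thesis
        using close[OF _ True xy] gain_le_V[OF w, of y] w by (fastforce simp: starting_def)
    next
      case False
      have "r \<le> norm y" using annulus[of y] xy by (simp add: u_def)
      then have "c \<le> g (norm y)" using class_KinfD(4)[OF g, of r "norm y"] r by (simp add: c_def)
      also have "\<dots> \<le> V i y" by (rule V_sandwich(1)[OF i])
      finally have "gain w x \<le> V i y" using False by linarith
      moreover have "M * norm (x - y) \<ge> 0" by (simp add: M_def)
      ultimately show ?thesis by linarith
    qed
  qed
  moreover have "M \<ge> 0" by (simp add: M_def)
  ultimately show ?thesis using u by blast
qed

lemma V_Lip0:
  assumes i: "i \<in> {1..m}"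
  shows "V i \<in> Lip0"
  unfolding Lip0_def
proof (intro CollectI local_lipschitzI)
  fix x0 :: 'a and t :: real assume "x0 \<in> - {0}"
  then obtain u M where u: "u > 0" "M \<ge> 0"
    and M: "\<And>x y. x \<in> cball x0 u \<Longrightarrow> y \<in> cball x0 u \<Longrightarrow> V i x \<le> V i y + M * norm (x - y)"
    using V_locally_Lipschitz[of x0] i by auto
  have "M-lipschitz_on (cball x0 u \<inter> - {0}) (V i)"
  proof (rule lipschitz_onI)
    fix x y assume "x \<in> cball x0 u \<inter> - {0}" "y \<in> cball x0 u \<inter> - {0}"
    then have "V i x \<le> V i y + M * norm (x - y)" "V i y \<le> V i x + M * norm (y - x)"
      using M by blast+
    then show "dist (V i x) (V i y) \<le> M * dist x y"
      by (simp add: dist_norm norm_minus_commute abs_le_iff)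
  qed (rule u)
  then show "\<exists>u>0. \<exists>L. \<forall>t\<in>cball t u \<inter> UNIV. L-lipschitz_on (cball x0 u \<inter> - {0}) (V i)"
    using u by blast
qed

end

section \<open>The characterization\<close>

lemma tau_UGB_iff_words:
  fixes f :: "nat \<Rightarrow> 'a::euclidean_space \<Rightarrow> 'a"
  assumes "m \<ge> 1" and f: "\<forall>i\<in>{1..m}. f i \<in> Sigma_class" and "\<tau> > 0"
  shows "tau_UGB m f \<tau> \<longleftrightarrow> (\<exists>\<eta>1\<in>class_Kinf. \<exists>\<eta>2\<in>class_Kinf. \<exists>\<alpha>\<ge>0. \<forall>w\<in>words m. \<forall>x.
    norm (word_flow f w x) \<le> \<eta>1 (exp (\<alpha> * \<tau> * real (length w)) * exp (- (1 + \<alpha>) * duration w) * \<eta>2 (norm x)))"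
proof -
  let ?signals = "\<lambda>\<eta>1 \<eta>2 \<alpha>. \<forall>\<sigma>\<in>switching_signals m. \<forall>x. \<forall>t\<ge>0. norm (switched_flow f \<sigma> t x)
      \<le> \<eta>1 (exp (\<alpha> * \<tau> * real (num_disc \<sigma> 0 t)) * exp (- (1 + \<alpha>) * t) * \<eta>2 (norm x))"
  let ?words = "\<lambda>\<eta>1 \<eta>2 \<alpha>. \<forall>w\<in>words m. \<forall>x. norm (word_flow f w x)
      \<le> \<eta>1 (exp (\<alpha> * \<tau> * real (length w)) * exp (- (1 + \<alpha>) * duration w) * \<eta>2 (norm x))"
  have 1: "?words \<eta>1 \<eta>2 \<alpha>" if \<eta>: "\<eta>1 \<in> class_Kinf" "\<eta>2 \<in> class_Kinf" and "0 \<le> \<alpha>"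
    and ugb: "?signals \<eta>1 \<eta>2 \<alpha>" for \<eta>1 \<eta>2 \<alpha>
  proof (intro ballI allI)
    fix w and x :: 'a
    assume w: "w \<in> words m"
    let ?\<sigma> = "word_signal w"
    have \<sigma>: "?\<sigma> \<in> switching_signals m" "num_disc ?\<sigma> 0 (duration w) \<le> length w"
        "switched_flow f ?\<sigma> (duration w) x = word_flow f w x"
      using word_signal_properties[OF f assms(1) w] by simp_all
    let ?e = "\<lambda>n. exp (\<alpha> * \<tau> * real n) * exp (- (1 + \<alpha>) * duration w) * \<eta>2 (norm x)"
    have "norm (switched_flow f ?\<sigma> (duration w) x) \<le> \<eta>1 (?e (num_disc ?\<sigma> 0 (duration w)))"
      using ugb[THEN bspec, OF \<sigma>(1), THEN spec, THEN spec, THEN mp, OF duration_nonneg[OF w]] .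
    also have "\<dots> \<le> \<eta>1 (?e (length w))"
    proof -
      have n0: "\<eta>2 (norm x) \<ge> 0" using class_KinfD(5)[OF \<eta>(2)] by simp
      have "\<alpha> * \<tau> * real (num_disc ?\<sigma> 0 (duration w)) \<le> \<alpha> * \<tau> * real (length w)"
        using \<sigma>(2) \<open>0 \<le> \<alpha>\<close> \<open>\<tau> > 0\<close> by (intro mult_left_mono) auto
      then have le: "?e (num_disc ?\<sigma> 0 (duration w)) \<le> ?e (length w)" using n0 by (intro mult_right_mono) auto
      have "0 \<le> ?e (num_disc ?\<sigma> 0 (duration w))" "0 \<le> ?e (length w)" using n0 by simp_all
      from class_KinfD(4)[OF \<eta>(1) this] le show ?thesis by blast
    qed
    finally show "norm (word_flow f w x) \<le> \<eta>1 (?e (length w))" by (simp only: \<sigma>(3))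
  qed
  have 2: "?signals \<eta>1 \<eta>2 \<alpha>" if words: "?words \<eta>1 \<eta>2 \<alpha>" for \<eta>1 \<eta>2 \<alpha>
  proof (intro ballI allI impI)
    fix \<sigma> and x :: 'a and t :: real assume \<sigma>: "\<sigma> \<in> switching_signals m" and "0 \<le> t"
    obtain w where w: "w \<in> words m" "length w = num_disc \<sigma> 0 t" "duration w = t"
        "\<forall>x. switched_flow f \<sigma> t x = word_flow f w x"
      using switched_flow_eq_word_flow[OF f \<sigma> \<open>0 \<le> t\<close>] by (elim bexE conjE)
    show "norm (switched_flow f \<sigma> t x)
        \<le> \<eta>1 (exp (\<alpha> * \<tau> * real (num_disc \<sigma> 0 t)) * exp (- (1 + \<alpha>) * t) * \<eta>2 (norm x))"
      using words[THEN bspec, OF w(1), THEN spec, of x] by (simp only: w)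
  qed
  have "?signals \<eta>1 \<eta>2 \<alpha> \<longleftrightarrow> ?words \<eta>1 \<eta>2 \<alpha>"
    if "\<eta>1 \<in> class_Kinf" "\<eta>2 \<in> class_Kinf" "0 \<le> \<alpha>" for \<eta>1 \<eta>2 \<alpha>
    using 1[OF that] 2[of \<eta>1 \<alpha> \<eta>2] by (rule iffI)
  then show ?thesis
    unfolding tau_UGB_def by (intro bex_cong[OF refl] ex_cong1 conj_cong[OF refl])
qed

text \<open>Along the first letter \<open>(i, h)\<close> the function \<open>W i\<close> decays, and passing to it from an arbitrary
  \<open>W j\<close> costs one factor \<open>exp (\<alpha> * \<tau>)\<close>. Letting \<open>j\<close> be arbitrary makes the number of factors equal to
  the length of the word.\<close>

lemma Lyapunov_functions_bound_words:
  fixes f :: "nat \<Rightarrow> 'a::euclidean_space \<Rightarrow> 'a"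
  assumes f: "\<forall>i\<in>{1..m}. f i \<in> Sigma_class"
    and W_Lip: "\<forall>i\<in>{1..m}. W i \<in> Lip0" and a1: "a1 \<in> class_Kinf" and a2: "a2 \<in> class_Kinf"
    and sandwich: "\<forall>i\<in>{1..m}. \<forall>x. a1 (norm x) \<le> W i x \<and> W i x \<le> a2 (norm x)"
    and dini: "\<forall>i\<in>{1..m}. \<forall>x. upper_dini (f i) (W i) x \<le> ereal (- (1 + \<alpha>) * W i x)"
    and switch: "\<forall>i\<in>{1..m}. \<forall>j\<in>{1..m}. \<forall>x. W i x \<le> exp (\<alpha> * \<tau>) * W j x"
    and w: "w \<in> words m" and j: "j \<in> {1..m}"
  shows "a1 (norm (word_flow f w x)) \<le> exp (\<alpha> * \<tau> * real (length w)) * exp (- (1 + \<alpha>) * duration w) * W j x"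
  using w j
proof (induction w arbitrary: x j)
  case Nil
  then show ?case using sandwich by simp
next
  case (Cons p w)
  obtain i h where p: "p = (i, h)" by (cases p)
  have ih: "i \<in> {1..m}" "0 \<le> h" "w \<in> words m" using Cons.prems(1) by (simp_all add: p)
  have "continuous_on UNIV (W i)"
    by (rule continuous_on_sandwiched_Lip0[OF bspec[OF W_Lip ih(1)] a1 a2]) (rule bspec[OF sandwich ih(1), THEN spec])
  then have "W i (mode_flow (f i) h x) \<le> exp (- (1 + \<alpha>) * h) * W i x"
    by (rule Dini_decay_along_mode[OF bspec[OF f ih(1)] _ _ ih(2)]) (rule bspec[OF dini ih(1), THEN spec])
  also have "\<dots> \<le> exp (- (1 + \<alpha>) * h) * (exp (\<alpha> * \<tau>) * W j x)"
    using switch ih(1) Cons.prems(2) by (intro mult_left_mono) auto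
  finally have "exp (\<alpha> * \<tau> * real (length w)) * exp (- (1 + \<alpha>) * duration w) * W i (mode_flow (f i) h x)
      \<le> exp (\<alpha> * \<tau> * real (length w)) * exp (- (1 + \<alpha>) * duration w) * (exp (- (1 + \<alpha>) * h) * (exp (\<alpha> * \<tau>) * W j x))"
    by (intro mult_left_mono) auto
  also have "\<dots> = exp (\<alpha> * \<tau> * real (length (p # w))) * exp (- (1 + \<alpha>) * duration (p # w)) * W j x"
  proof -
    have "exp (\<alpha> * \<tau> * real (length (p # w))) = exp (\<alpha> * \<tau>) * exp (\<alpha> * \<tau> * real (length w))"
      by (simp add: mult_exp_exp algebra_simps)
    moreover have "exp (- (1 + \<alpha>) * duration (p # w)) = exp (- (1 + \<alpha>) * h) * exp (- (1 + \<alpha>) * duration w)"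
      by (simp add: p mult_exp_exp algebra_simps)
    ultimately show ?thesis by (simp only: mult_ac)
  qed
  finally show ?case using Cons.IH[OF ih(3,1), of "mode_flow (f i) h x"] by (simp add: p)
qed

theorem theorem1:
  fixes f :: "nat \<Rightarrow> real ^ 'n \<Rightarrow> real ^ 'n" and m :: nat and \<tau> :: real
  assumes "m \<ge> 1"
    and "\<forall>i\<in>{1..m}. f i \<in> Sigma_class"
    and "\<tau> > 0"
  shows "tau_UGB m f \<tau> \<longleftrightarrow>
    (\<exists>W :: nat \<Rightarrow> real ^ 'n \<Rightarrow> real. \<exists>\<alpha>1\<in>class_Kinf. \<exists>\<alpha>2\<in>class_Kinf. \<exists>\<alpha>\<ge>0.
       (\<forall>i\<in>{1..m}. W i \<in> Lip0) \<and>
       (\<forall>i\<in>{1..m}. \<forall>x. \<alpha>1 (norm x) \<le> W i x \<and> W i x \<le> \<alpha>2 (norm x)) \<and>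
       (\<forall>i\<in>{1..m}. \<forall>x. upper_dini (f i) (W i) x \<le> ereal (- (1 + \<alpha>) * W i x)) \<and>
       (\<forall>i\<in>{1..m}. \<forall>j\<in>{1..m}. \<forall>x. W i x \<le> exp (\<alpha> * \<tau>) * W j x))"
    (is "_ \<longleftrightarrow> ?lyap")
proof
  assume "tau_UGB m f \<tau>"
  then obtain \<eta>1 \<eta>2 \<alpha> where \<eta>: "\<eta>1 \<in> class_Kinf" "\<eta>2 \<in> class_Kinf" "\<alpha> \<ge> 0"
    and ugb: "\<forall>w\<in>words m. \<forall>x. norm (word_flow f w x)
      \<le> \<eta>1 (exp (\<alpha> * \<tau> * real (length w)) * exp (- (1 + \<alpha>) * duration w) * \<eta>2 (norm x))"
    unfolding tau_UGB_iff_words[OF assms] by (elim bexE exE conjE)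
  obtain \<kappa> where \<kappa>: "\<kappa> \<in> class_Kinf" "\<forall>r\<ge>0. \<kappa> (\<eta>1 r) = r"
    using class_Kinf_inverse[OF \<eta>(1)] by (elim bexE)
  obtain g where g: "g \<in> class_Kinf" "\<forall>r\<ge>0. g r \<le> 1 * \<kappa> r ^ 3"
      "\<forall>r\<ge>0. \<forall>s\<ge>0. \<bar>g r - g s\<bar> \<le> \<bar>r - s\<bar>"
    using class_Kinf_Lipschitz_minorant[OF class_Kinf_cube[OF \<kappa>(1) zero_less_one]]
    by (elim bexE conjE)
  interpret decaying_words f m \<tau> \<alpha> g "\<lambda>r. 1 * \<eta>2 r ^ 3"
  proof
    show "(\<lambda>r. 1 * \<eta>2 r ^ 3) \<in> class_Kinf" by (rule class_Kinf_cube[OF \<eta>(2) zero_less_one])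
    fix w and x :: "real ^ 'n" assume w: "w \<in> words m"
    let ?e = "exp (\<alpha> * \<tau> * real (length w)) * exp (- (1 + \<alpha>) * duration w) * \<eta>2 (norm x)"
    have e0: "?e \<ge> 0" using class_KinfD(5)[OF \<eta>(2), of "norm x"] by simp
    have \<eta>1e: "\<eta>1 ?e \<ge> 0" using class_KinfD(5)[OF \<eta>(1) e0] .
    have "\<kappa> (norm (word_flow f w x)) \<le> \<kappa> (\<eta>1 ?e)"
      using class_KinfD(4)[OF \<kappa>(1) norm_ge_zero \<eta>1e] ugb[THEN bspec, OF w, THEN spec, of x] by (rule iffD2)
    then have "\<kappa> (norm (word_flow f w x)) \<le> ?e" using \<kappa>(2) e0 by simp
    then have "\<kappa> (norm (word_flow f w x)) ^ 3 \<le> ?e ^ 3"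
      using class_KinfD(5)[OF \<kappa>(1) norm_ge_zero] by (rule power_mono)
    also have "\<dots> = exp (3 * (\<alpha> * \<tau> * real (length w) - (1 + \<alpha>) * duration w)) * \<eta>2 (norm x) ^ 3"
    proof -
      have "?e = exp (\<alpha> * \<tau> * real (length w) - (1 + \<alpha>) * duration w) * \<eta>2 (norm x)"
        by (simp add: mult_exp_exp) (simp add: algebra_simps)
      then show ?thesis by (simp only: power_mult_distrib exp_of_nat_mult[symmetric] of_nat_numeral)
    qed
    finally show "g (norm (word_flow f w x))
        \<le> exp (3 * (\<alpha> * \<tau> * real (length w) - (1 + \<alpha>) * duration w)) * (1 * \<eta>2 (norm x) ^ 3)"
      using g(2)[THEN spec, of "norm (word_flow f w x)"] by simp
  next
    show "\<bar>g r - g s\<bar> \<le> \<bar>r - s\<bar>" if "r \<ge> 0" "s \<ge> 0" for r s using g(3) that by simp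
  qed (fact assms(2,3) \<eta>(3) g(1))+
  have E': "(\<lambda>r. exp (\<beta> * \<tau>) * \<eta>2 r ^ 3) \<in> class_Kinf"
    by (rule class_Kinf_cube[OF \<eta>(2)]) simp
  show ?lyap
  proof (rule exI[of _ V], rule bexI[OF _ g(1)], rule bexI[OF _ E'], intro exI[of _ \<beta>] conjI ballI allI)
    show "V i x \<le> exp (\<beta> * \<tau>) * \<eta>2 (norm x) ^ 3" if "i \<in> {1..m}" for i x
      using V_sandwich(2)[OF that, of x] by simp
    show "0 \<le> \<beta>" using beta_pos by simp
  qed (fact V_Lip0 V_sandwich(1) upper_dini_V V_switch)+
next
  assume ?lyap
  then obtain W a1 a2 \<alpha> where a: "a1 \<in> class_Kinf" "a2 \<in> class_Kinf" "\<alpha> \<ge> 0"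
    and W: "\<forall>i\<in>{1..m}. W i \<in> Lip0"
      "\<forall>i\<in>{1..m}. \<forall>x. a1 (norm x) \<le> W i x \<and> W i x \<le> a2 (norm x)"
      "\<forall>i\<in>{1..m}. \<forall>x. upper_dini (f i) (W i) x \<le> ereal (- (1 + \<alpha>) * W i x)"
      "\<forall>i\<in>{1..m}. \<forall>j\<in>{1..m}. \<forall>x. W i x \<le> exp (\<alpha> * \<tau>) * W j x"
    by (elim bexE exE conjE)
  obtain b where b: "b \<in> class_Kinf" "\<forall>r\<ge>0. b (a1 r) = r"
    using class_Kinf_inverse[OF a(1)] by (elim bexE)
  have "norm (word_flow f w x)
      \<le> b (exp (\<alpha> * \<tau> * real (length w)) * exp (- (1 + \<alpha>) * duration w) * a2 (norm x))"
    if w: "w \<in> words m" for w x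
  proof -
    have one: "1 \<in> {1..m}" using assms(1) by simp
    let ?e = "exp (\<alpha> * \<tau> * real (length w)) * exp (- (1 + \<alpha>) * duration w)"
    have "a1 (norm (word_flow f w x)) \<le> ?e * W 1 x"
      by (rule Lyapunov_functions_bound_words[OF assms(2) W(1) a(1,2) W(2,3,4) w one])
    also have "\<dots> \<le> ?e * a2 (norm x)" using W(2) one by (intro mult_left_mono) auto
    finally have le: "a1 (norm (word_flow f w x)) \<le> ?e * a2 (norm x)" .
    have "0 \<le> a1 (norm (word_flow f w x))" using class_KinfD(5)[OF a(1)] by simp
    then have "b (a1 (norm (word_flow f w x))) \<le> b (?e * a2 (norm x))"
      using class_KinfD(4)[OF b(1)] le by simp
    then show ?thesis using b(2) by simp
  qed
  then show "tau_UGB m f \<tau>"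
    unfolding tau_UGB_iff_words[OF assms]
    by (intro bexI[OF _ b(1)] bexI[OF _ a(2)] exI[of _ \<alpha>] conjI ballI allI a(3))
qed

end
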